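(* Let $f:\mathcal D\to\mathbb R$ be real-analytic and bounded below. Let the retraction $R$ used in the line-search algorithm described in the context be the metric projection, i.e. $R(x,\xi_x)\in\arg\min_{y\in\mathcal M}\|y-(x+\xi_x)\|$ (the choice of norm on $\mathbb R^N$ in this minimization does not matter). Let $(x_n)$ be a sequence produced by the algorithm, and assume that a cluster point $x^*$ of $(x_n)$ exists, satisfies the Łojasiewicz inequality (L) for the projected antigradient with exponent $\theta\in(0,1/2]$, and possesses an open neighborhood $\mathcal O\subseteq\mathbb R^N$ such that $\mathcal M\cap\mathcal O$ is a smooth embedded submanifold of $\mathbb R^N$. Then there exist $\sigma,\kappa>0$ such that for all sufficiently large $n$: (A1) $f(x_{n+1})-f(x_n)\le-\sigma g^-(x_n)\|x_{n+1}-x_n\|$; (A2) $g^-(x_n)=0\Rightarrow x_{n+1}=x_n$; (A3) $\|x_{n+1}-x_n\|\ge\kappa g^-(x_n)$. Consequently, $\lim_{n\to\infty}x_n=x^*$ with the rate of convergence (up to a multiplicative constant independent of $n$) \[ \|x_n-x^*\|\lesssim\begin{cases}e^{-an}&\text{if }\theta=\tfrac12\ (\text{for some }a>0),\\ n^{-\frac{\theta}{1-2\theta}}&\text{if }0<\theta<\tfrac12,\end{cases} \] and $\lim_{n\to\infty}g^-(x_n)=g^-(x^* )=0$.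
   Context: $\mathcal D\subseteq\mathbb R^N$ is open, $\mathcal M\subset\mathcal D$ is closed, $\|\cdot\|$ is the Euclidean norm. Tangent cone at $x\in\mathcal M$: $T_x\mathcal M=\{\xi\in\mathbb R^N:\exists (y_j)\subseteq\mathcal M,\ (a_j)\subseteq\mathbb R^+,\ y_j\to x,\ a_j(y_j-x)\to\xi\}$. Projected antigradient norm: $g^-(x)=\sqrt{\|\nabla f(x)\|^2-\mathrm{dist}(-\nabla f(x),T_x\mathcal M)^2}=\max\{-\nabla f(x)^{\mathsf T}\xi:\xi\in T_x\mathcal M,\|\xi\|\le1\}$. (L) at $x\in\mathcal M$ with exponent $\theta\in(0,1/2]$: there exist $\delta,\Lambda>0$ such that $|f(y)-f(x)|^{1-\theta}\le\Lambda g^-(y)$ for all $y\in\mathcal M$ with $\|y-x\|<\delta$. Retraction: a map $R:\bigcup_{x\in\mathcal M}\{x\}\times T_x\mathcal M\to\mathcal M$ such that for every fixed $x\in\mathcal M$, $\xi_x\in T_x\mathcal M$, the map $\alpha\mapsto R(x,\alpha\xi_x)$ is continuous on $[0,\infty)$ and $\lim_{\alpha\to0^+}\frac{R(x,\alpha\xi_x)-(x+\alpha\xi_x)}{\alpha}=0$. It is assumed throughout that there is a constant $M$ with $\|R(x,\xi_x)-x\|\le M\|\xi_x\|$ for all $x\in\mathcal M$, $\xi_x\in T_x\mathcal M$ (in particular $R(x,0)=x$). The metric projection above is assumed to be (a choice defining) such a retraction. Line-search algorithm (gradient-related projection method). Input: $x_0\in\mathcal M$, $\omega\in(0,1]$,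 $\beta,c\in(0,1)$. For $n=0,1,2,\dots$: 1. Choose $\xi_n\in T_{x_n}\mathcal M$ satisfying the $\omega$-angle condition $\nabla f(x_n)^{\mathsf T}\xi_n\le-\omega g^-(x_n)\|\xi_n\|$, with $\xi_n=0$ if and only if $g^-(x_n)=0$. If $\xi_n=0$, then $x_{n+1}=x_n$. 2. If $\xi_n\neq0$, choose $\bar\beta_n\ge\min\big(g^-(x_n)/\|\xi_n\|,\bar\alpha_n\big)$, where $\bar\alpha_n=\min\{\alpha>0: f(R(x_n,\alpha\xi_n))-f(x_n)=c\alpha\nabla f(x_n)^{\mathsf T}\xi_n\}$, and let $\alpha_n$ be the Armijo point $\alpha_n=\max\{\beta^m\bar\beta_n: m\in\mathbb N\cup\{0\},\ f(R(x_n,\beta^m\bar\beta_n\xi_n))-f(x_n)\le c\beta^m\bar\beta_n\nabla f(x_n)^{\mathsf T}\xi_n\}$. 3. Set $x_{n+1}=R(x_n,\alpha_n\xi_n)$. *)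

theory Defs
  imports "HOL-Analysis.Analysis"
begin

text \<open>A function is real-analytic on an open set \<open>D\<close> if near each point of \<open>D\<close> it is the sum of
  its power series in several variables; \<open>\<nu>\<close> ranges over all multi-indices, and \<open>has_sum\<close> is
  unconditional (hence absolute) convergence.\<close>

definition real_analytic_on :: "(real ^ 'n::finite \<Rightarrow> real) \<Rightarrow> (real ^ 'n) set \<Rightarrow> bool" where
  "real_analytic_on f D \<longleftrightarrow>
     (\<forall>x\<in>D. \<exists>r>0. \<exists>a :: ('n \<Rightarrow> nat) \<Rightarrow> real. \<forall>y\<in>ball x r.
        ((\<lambda>\<nu>. a \<nu> * (\<Prod>i\<in>UNIV. (y $ i - x $ i) ^ \<nu> i)) has_sum f y) UNIV)"

definition grad :: "(real ^ 'n::finite \<Rightarrow> real) \<Rightarrow> real ^ 'n \<Rightarrow> real ^ 'n" where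
  "grad f x = (THE v. GDERIV f x :> v)"

definition tangent_cone :: "(real ^ 'n::finite) set \<Rightarrow> real ^ 'n \<Rightarrow> (real ^ 'n) set" where
  "tangent_cone M x =
     {\<xi>. \<exists>(y :: nat \<Rightarrow> real ^ 'n) (a :: nat \<Rightarrow> real).
        (\<forall>j. y j \<in> M) \<and> (\<forall>j. a j > 0) \<and> y \<longlonglongrightarrow> x \<and> (\<lambda>j. a j *\<^sub>R (y j - x)) \<longlonglongrightarrow> \<xi>}"

definition proj_antigrad_norm ::
    "(real ^ 'n::finite) set \<Rightarrow> (real ^ 'n \<Rightarrow> real) \<Rightarrow> real ^ 'n \<Rightarrow> real" where
  "proj_antigrad_norm M f x =
     sqrt ((norm (grad f x))\<^sup>2 - (infdist (- grad f x) (tangent_cone M x))\<^sup>2)"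

definition lojasiewicz_at ::
    "(real ^ 'n::finite) set \<Rightarrow> (real ^ 'n \<Rightarrow> real) \<Rightarrow> real \<Rightarrow> real ^ 'n \<Rightarrow> bool" where
  "lojasiewicz_at M f \<theta> x \<longleftrightarrow>
     (\<exists>\<delta>>0. \<exists>\<Lambda>>0. \<forall>y\<in>M. norm (y - x) < \<delta> \<longrightarrow>
        \<bar>f y - f x\<bar> powr (1 - \<theta>) \<le> \<Lambda> * proj_antigrad_norm M f y)"

text \<open>\<open>Ck_map k f U\<close> is meaningful for open \<open>U\<close> only: \<open>f\<close> is \<open>k\<close> times continuously differentiable
  iff it is differentiable and all its directional derivatives are \<open>k - 1\<close> times continuously
  differentiable.\<close>

primrec Ck_map ::
    "nat \<Rightarrow> ('a::euclidean_space \<Rightarrow> 'b::euclidean_space) \<Rightarrow> 'a set \<Rightarrow> bool" where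
  "Ck_map 0 f U \<longleftrightarrow> continuous_on U f"
| "Ck_map (Suc k) f U \<longleftrightarrow>
     (\<forall>x\<in>U. f differentiable (at x)) \<and> (\<forall>v. Ck_map k (\<lambda>x. frechet_derivative f (at x) v) U)"

definition smooth_map :: "('a::euclidean_space \<Rightarrow> 'b::euclidean_space) \<Rightarrow> 'a set \<Rightarrow> bool" where
  "smooth_map f U \<longleftrightarrow> (\<forall>k. Ck_map k f U)"

text \<open>Submanifold by slice charts: around each of its points some diffeomorphism between open sets
  of the ambient space flattens \<open>S\<close> to a \<open>k\<close>-dimensional linear subspace.\<close>

definition smooth_embedded_submanifold :: "'a::euclidean_space set \<Rightarrow> bool" where
  "smooth_embedded_submanifold S \<longleftrightarrow>
     (\<exists>k. \<forall>p\<in>S. \<exists>U V \<phi> \<psi>. \<exists>L :: 'a set.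
        open U \<and> open V \<and> p \<in> U \<and> homeomorphism U V \<phi> \<psi> \<and> smooth_map \<phi> U \<and> smooth_map \<psi> V \<and>
        subspace L \<and> dim L = k \<and> \<phi> ` (S \<inter> U) = V \<inter> L)"

text \<open>\<open>R x \<xi>\<close> is relevant for \<open>x \<in> M\<close> and \<open>\<xi> \<in> tangent_cone M x\<close> only.\<close>

definition tangent_cone_retraction ::
    "(real ^ 'n::finite) set \<Rightarrow> (real ^ 'n \<Rightarrow> real ^ 'n \<Rightarrow> real ^ 'n) \<Rightarrow> bool" where
  "tangent_cone_retraction M R \<longleftrightarrow>
     (\<forall>x\<in>M. \<forall>\<xi>\<in>tangent_cone M x.
        R x \<xi> \<in> M \<and>
        continuous_on {0..} (\<lambda>\<alpha>. R x (\<alpha> *\<^sub>R \<xi>)) \<and>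
        ((\<lambda>\<alpha>. (R x (\<alpha> *\<^sub>R \<xi>) - (x + \<alpha> *\<^sub>R \<xi>)) /\<^sub>R \<alpha>) \<longlongrightarrow> 0) (at_right 0))"

definition linearly_bounded_map ::
    "(real ^ 'n::finite) set \<Rightarrow> (real ^ 'n \<Rightarrow> real ^ 'n \<Rightarrow> real ^ 'n) \<Rightarrow> bool" where
  "linearly_bounded_map M R \<longleftrightarrow>
     (\<exists>C. \<forall>x\<in>M. \<forall>\<xi>\<in>tangent_cone M x. norm (R x \<xi> - x) \<le> C * norm \<xi>)"

definition is_norm :: "('a::real_vector \<Rightarrow> real) \<Rightarrow> bool" where
  "is_norm N \<longleftrightarrow>
     (\<forall>x. N x = 0 \<longleftrightarrow> x = 0) \<and> (\<forall>a x. N (a *\<^sub>R x) = \<bar>a\<bar> * N x) \<and> (\<forall>x y. N (x + y) \<le> N x + N y)"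

definition metric_projection ::
    "(real ^ 'n::finite \<Rightarrow> real) \<Rightarrow> (real ^ 'n) set \<Rightarrow> (real ^ 'n \<Rightarrow> real ^ 'n \<Rightarrow> real ^ 'n) \<Rightarrow> bool" where
  "metric_projection N M R \<longleftrightarrow>
     (\<forall>x\<in>M. \<forall>\<xi>\<in>tangent_cone M x.
        is_arg_min (\<lambda>y. N (y - (x + \<xi>))) (\<lambda>y. y \<in> M) (R x \<xi>))"

definition first_armijo_equality ::
    "(real ^ 'n::finite \<Rightarrow> real) \<Rightarrow> (real ^ 'n \<Rightarrow> real ^ 'n \<Rightarrow> real ^ 'n) \<Rightarrow> real
      \<Rightarrow> real ^ 'n \<Rightarrow> real ^ 'n \<Rightarrow> real" where
  "first_armijo_equality f R c x \<xi> =
     (LEAST \<alpha>. \<alpha> > 0 \<and> f (R x (\<alpha> *\<^sub>R \<xi>)) - f x = c * \<alpha> * (grad f x \<bullet> \<xi>))"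

definition armijo_step_size ::
    "(real ^ 'n::finite \<Rightarrow> real) \<Rightarrow> (real ^ 'n \<Rightarrow> real ^ 'n \<Rightarrow> real ^ 'n) \<Rightarrow> real \<Rightarrow> real
      \<Rightarrow> real ^ 'n \<Rightarrow> real ^ 'n \<Rightarrow> real \<Rightarrow> real" where
  "armijo_step_size f R \<beta> c x \<xi> b =
     (GREATEST \<alpha>. \<exists>m::nat. \<alpha> = \<beta> ^ m * b \<and> f (R x (\<alpha> *\<^sub>R \<xi>)) - f x \<le> c * \<alpha> * (grad f x \<bullet> \<xi>))"

text \<open>One iteration from \<open>x\<close> to \<open>x'\<close>; the free choices of the search direction \<open>\<xi>\<close> and of the
  initial step size \<open>b\<close> are existentially quantified.\<close>

definition line_search_step ::
    "(real ^ 'n::finite) set \<Rightarrow> (real ^ 'n \<Rightarrow> real) \<Rightarrow> (real ^ 'n \<Rightarrow> real ^ 'n \<Rightarrow> real ^ 'n)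
      \<Rightarrow> real \<Rightarrow> real \<Rightarrow> real \<Rightarrow> real ^ 'n \<Rightarrow> real ^ 'n \<Rightarrow> bool" where
  "line_search_step M f R \<omega> \<beta> c x x' \<longleftrightarrow>
     (\<exists>\<xi>\<in>tangent_cone M x.
        grad f x \<bullet> \<xi> \<le> - \<omega> * proj_antigrad_norm M f x * norm \<xi> \<and>
        (\<xi> = 0 \<longleftrightarrow> proj_antigrad_norm M f x = 0) \<and>
        (\<xi> = 0 \<longrightarrow> x' = x) \<and>
        (\<xi> \<noteq> 0 \<longrightarrow>
           (\<exists>b. b \<ge> min (proj_antigrad_norm M f x / norm \<xi>) (first_armijo_equality f R c x \<xi>) \<and>
                x' = R x (armijo_step_size f R \<beta> c x \<xi> b *\<^sub>R \<xi>))))"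

definition line_search_sequence ::
    "(real ^ 'n::finite) set \<Rightarrow> (real ^ 'n \<Rightarrow> real) \<Rightarrow> (real ^ 'n \<Rightarrow> real ^ 'n \<Rightarrow> real ^ 'n)
      \<Rightarrow> real \<Rightarrow> real \<Rightarrow> real \<Rightarrow> (nat \<Rightarrow> real ^ 'n) \<Rightarrow> bool" where
  "line_search_sequence M f R \<omega> \<beta> c x \<longleftrightarrow>
     x 0 \<in> M \<and> (\<forall>n. line_search_step M f R \<omega> \<beta> c (x n) (x (Suc n)))"

definition cluster_point :: "(nat \<Rightarrow> 'a::topological_space) \<Rightarrow> 'a \<Rightarrow> bool" where
  "cluster_point x l \<longleftrightarrow> (\<exists>r :: nat \<Rightarrow> nat. strict_mono r \<and> (x \<circ> r) \<longlonglongrightarrow> l)"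

end

theory Submission
  imports Defs
begin

text \<open>The proof combines a local second-order analysis of one step of the algorithm with the
  classical trajectory argument of Lojasiewicz.

  \<^bold>\<open>One step.\<close> Everything of second order enters through one notion, \<open>quadratic_expansion\<close>: a
  first-order Taylor formula whose remainder is at most \<open>K * (norm (w - u))\<^sup>2\<close>, with one constant for all
  base points \<open>u\<close> of a ball. Sums of power series have such expansions
  (\<open>real_analytic_quadratic_expansion\<close>), and so have smooth charts (\<open>C2_quadratic_expansion\<close>). In a chart
  of the submanifold, moving from \<open>x\<close> along a tangent vector \<open>\<xi>\<close> and mapping back produces a point of
  \<open>M\<close> at distance \<open>O((norm \<xi>)\<^sup>2)\<close> from \<open>x + \<xi>\<close>; the metric projection does at least as well up to the
  constant that compares the chosen norm with the Euclidean one
  (\<open>metric_projection_second_order\<close>). Hence \<open>f (R x \<xi>)\<close> agrees with \<open>f x + grad f x \<bullet> \<xi>\<close> up to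
  \<open>O((norm \<xi>)\<^sup>2)\<close>, uniformly near the cluster point. The Armijo inequality can therefore first become an
  equality only at a displacement \<open>\<eta>\<close> with \<open>norm \<eta>\<close> at least a constant times the projected
  antigradient norm \<open>g x\<close>, and the accepted displacement is at least \<open>\<beta>\<close> times the smaller of \<open>g x\<close> and
  \<open>norm \<eta>\<close>. This gives a lower bound on the step length in terms of \<open>g x\<close>
  (\<open>step_length_lower_bound\<close>), while the Armijo inequality itself gives, at every point, a decrease
  proportional to \<open>g x\<close> times the step length (\<open>sufficient_decrease\<close>).

  \<^bold>\<open>The trajectory.\<close> Put \<open>e n = f (x n) - f xs\<close>. This decrease, the Lojasiewicz inequality and the concavity
  of \<open>t \<mapsto> t powr \<theta>\<close> bound the step length by a multiple of \<open>e n powr \<theta> - e (Suc n) powr \<theta>\<close> as long as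
  the iterates stay near the cluster point. The bounds telescope, so the iterates are trapped there and
  \<open>norm (x n - xs) \<le> G * e n powr \<theta>\<close> (\<open>Lojasiewicz_trajectory_bound\<close>). With the lower bound
  on the step length, the decrease of \<open>e\<close> is at least a multiple of \<open>(g (x n))\<^sup>2\<close>, hence of
  \<open>e n powr (2 - 2 * \<theta>)\<close>. This recursion yields the exponential and the polynomial rate
  (\<open>geometric_decay\<close>, \<open>polynomial_decay\<close>), and since \<open>e\<close> tends to zero, so does \<open>g (x n)\<close>. Finally
  \<open>g xs = 0\<close>, since a descent direction in the tangent space at \<open>xs\<close> could be transported to the tangent
  spaces at the iterates (\<open>proj_antigrad_norm_limit_zero\<close>).\<close>

section \<open>Uniform quadratic expansions\<close>

text \<open>On balls this amounts to differentiability with Lipschitz derivative. The bound on \<open>g'\<close> is included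
  because the step analysis needs it uniformly, next to the remainder estimate; sharing the constant
  \<open>K\<close> keeps the bookkeeping short.\<close>

definition quadratic_expansion ::
    "('a::real_normed_vector \<Rightarrow> 'b::real_normed_vector) \<Rightarrow> ('a \<Rightarrow> 'a \<Rightarrow> 'b) \<Rightarrow> 'a set \<Rightarrow> real \<Rightarrow> bool"
where
  "quadratic_expansion g g' S K \<longleftrightarrow>
     (\<forall>u\<in>S. linear (g' u) \<and> (\<forall>h. norm (g' u h) \<le> K * norm h) \<and>
        (\<forall>w\<in>S. norm (g w - g u - g' u (w - u)) \<le> K * (norm (w - u))\<^sup>2))"

lemma quadratic_expansionD:
  assumes "quadratic_expansion g g' S K" and "u \<in> S"
  shows "linear (g' u)" and "norm (g' u h) \<le> K * norm h"
    and "w \<in> S \<Longrightarrow> norm (g w - g u - g' u (w - u)) \<le> K * (norm (w - u))\<^sup>2"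
  using assms unfolding quadratic_expansion_def by blast+

lemma quadratic_expansion_mono:
  assumes "quadratic_expansion g g' S K" and "T \<subseteq> S" and "K \<le> K'"
  shows "quadratic_expansion g g' T K'"
  unfolding quadratic_expansion_def
proof (intro ballI conjI allI)
  fix u assume u: "u \<in> T"
  then have uS: "u \<in> S" using assms by auto
  note D = quadratic_expansionD[OF assms(1) uS]
  show "linear (g' u)" by (rule D)
  show "norm (g' u h) \<le> K' * norm h" for h
    using D(2)[of h] assms(3) by (meson mult_right_mono norm_ge_zero order_trans)
  show "norm (g w - g u - g' u (w - u)) \<le> K' * (norm (w - u))\<^sup>2" if "w \<in> T" for w
    using D(3)[of w] assms(2,3) that by (meson mult_right_mono zero_le_power2 order_trans subsetD)
qed

lemma quadratic_expansion_has_derivative: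
  fixes g :: "'a::real_normed_vector \<Rightarrow> 'b::real_normed_vector"
  assumes "quadratic_expansion g g' S K" and "open S" and "u \<in> S"
  shows "(g has_derivative g' u) (at u)"
proof -
  note D = quadratic_expansionD[OF assms(1,3)]
  have bl: "bounded_linear (g' u)"
    by (rule bounded_linear_intro[of _ K])
      (use D(2) linear_add[OF D(1)] linear_scale[OF D(1)] in \<open>simp_all add: mult.commute\<close>)
  have "((\<lambda>w. norm (g w - g u - g' u (w - u)) / norm (w - u)) \<longlongrightarrow> 0) (at u)"
  proof (rule tendsto_sandwich[of "\<lambda>_. 0" _ _ "\<lambda>w. K * norm (w - u)"])
    have "eventually (\<lambda>w. w \<in> S) (at u)"
      using assms(2,3) by (rule eventually_at_in_open')
    then show "eventually (\<lambda>w. norm (g w - g u - g' u (w - u)) / norm (w - u) \<le> K * norm (w - u)) (at u)"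
    proof (rule eventually_mono)
      fix w assume "w \<in> S"
      from D(3)[OF this]
      show "norm (g w - g u - g' u (w - u)) / norm (w - u) \<le> K * norm (w - u)"
        by (cases "w = u") (auto simp: divide_simps power2_eq_square ac_simps)
    qed
    show "((\<lambda>w. K * norm (w - u)) \<longlongrightarrow> 0) (at u)"
      by (rule tendsto_eq_intros refl | simp)+
  qed auto
  then show ?thesis
    unfolding has_derivative_iff_norm using bl by simp
qed

text \<open>The three expansions that link \<open>u\<close>, \<open>w\<close> and \<open>w + k\<close> determine \<open>g' w k - g' u k\<close> up to remainders; taking
  \<open>norm k = norm (w - u)\<close> makes all of these remainders multiples of \<open>(norm (w - u))\<^sup>2\<close>. The radius is
  divided by three so that \<open>w + k\<close> stays in the ball.\<close>

lemma quadratic_expansion_derivative_Lipschitz: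
  fixes g :: "'a::real_normed_vector \<Rightarrow> 'b::real_normed_vector"
  assumes q: "quadratic_expansion g g' (ball p r) K"
    and u: "u \<in> ball p (r / 3)" and w: "w \<in> ball p (r / 3)"
  shows "norm (g' w h - g' u h) \<le> 6 * K * norm (w - u) * norm h"
proof (cases "w = u \<or> h = 0")
  case True
  have r: "r > 0" using u zero_le_dist[of p u] unfolding mem_ball by linarith
  have "linear (g' u)" "linear (g' w)"
    using q u w r by (auto simp: quadratic_expansion_def)
  then show ?thesis using True by (auto simp: linear_0)
next
  case False
  define d where "d = norm (w - u)"
  have d: "d > 0" using False by (simp add: d_def)
  define k where "k = (d / norm h) *\<^sub>R h"
  have nk: "norm k = d" using False d by (simp add: k_def)
  have uw: "dist p u < r/3" "dist p w < r/3" using u w by auto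
  then have r: "r > 0" using zero_le_dist[of p u] by linarith
  have "d < 2*r/3" using uw dist_triangle[of u w p] unfolding d_def by (simp add: dist_norm norm_minus_commute)
  then have wk: "w + k \<in> ball p r"
    using norm_triangle_ineq[of "w - p" k] uw nk by (simp add: dist_norm norm_minus_commute algebra_simps)
  have uS: "u \<in> ball p r" and wS: "w \<in> ball p r" using uw r by auto
  note Du = quadratic_expansionD[OF q uS] and Dw = quadratic_expansionD[OF q wS]
  have K: "K * norm k \<ge> 0" using Du(2)[of k] norm_ge_zero order_trans by blast
  then have K: "K \<ge> 0" using nk d by (simp add: zero_le_mult_iff)
  have e1: "norm (g (w+k) - g u - g' u (w + k - u)) \<le> K * (2*d)\<^sup>2"
  proof -
    have "norm (w + k - u) \<le> 2 * d"
      using norm_triangle_ineq[of "w - u" k] nk by (simp add: d_def algebra_simps)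
    then have "K * (norm (w + k - u))\<^sup>2 \<le> K * (2*d)\<^sup>2"
      using K by (intro mult_left_mono power_mono) auto
    then show ?thesis using Du(3)[OF wk] by simp
  qed
  have e2: "norm (g w - g u - g' u (w - u)) \<le> K * d\<^sup>2"
    using Du(3)[OF wS] by (simp add: d_def)
  have e3: "norm (g (w + k) - g w - g' w k) \<le> K * d\<^sup>2"
    using Dw(3)[OF wk] nk by simp
  have "g' u (w + k - u) = g' u (w - u) + g' u k"
    using linear_add[OF Du(1), of "w - u" k] by (simp add: algebra_simps)
  then have "g' w k - g' u k = (g (w+k) - g u - g' u (w + k - u))
      - (g w - g u - g' u (w - u)) - (g (w + k) - g w - g' w k)"
    by (simp add: algebra_simps)
  moreover have "norm ((g (w+k) - g u - g' u (w + k - u)) - (g w - g u - g' u (w - u))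
      - (g (w + k) - g w - g' w k)) \<le> K * (2*d)\<^sup>2 + K * d\<^sup>2 + K * d\<^sup>2"
    by (rule norm_triangle_le_diff, rule add_mono[OF norm_triangle_le_diff[OF add_mono[OF e1 e2]] e3])
  ultimately have "norm (g' w k - g' u k) \<le> K * (2*d)\<^sup>2 + K * d\<^sup>2 + K * d\<^sup>2" by metis
  also have "\<dots> = (d / norm h) * (6 * K * d * norm h)"
    using False by (simp add: power2_eq_square)
  finally have "norm (g' w k - g' u k) \<le> (d / norm h) * (6 * K * d * norm h)" .
  moreover have "g' w k - g' u k = (d / norm h) *\<^sub>R (g' w h - g' u h)"
    unfolding k_def using linear_scale[OF Du(1)] linear_scale[OF Dw(1)] by (simp add: scaleR_diff_right)
  ultimately have "(d / norm h) * norm (g' w h - g' u h) \<le> (d / norm h) * (6 * K * d * norm h)"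
    using d by (simp add: abs_of_nonneg)
  then have "norm (g' w h - g' u h) \<le> 6 * K * d * norm h"
    using d False by (subst (asm) mult_le_cancel_left_pos) auto
  then show ?thesis by (simp only: d_def)
qed

section \<open>Quadratic expansions of power series\<close>

text \<open>Splitting \<open>F (u + h)\<close> into its value, its linear part and its remainder, \<open>b\<^sub>0\<close>, \<open>b\<^sub>1\<close>, \<open>b\<^sub>2\<close> bound the three
  parts relative to \<open>1\<close>, \<open>l\<close>, \<open>l\<^sup>2\<close> with \<open>l = norm h / (2 * s)\<close>. Since \<open>l \<le> 1\<close> for two points of the ball,
  the total \<open>b\<^sub>0 + b\<^sub>1 + b\<^sub>2\<close> is submultiplicative. This is what lets a bound for one coordinate
  propagate to all monomials without any binomial expansion.\<close>

definition jet_majorized ::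
    "real \<Rightarrow> ('a::real_normed_vector \<Rightarrow> real) \<Rightarrow> ('a \<Rightarrow> 'a \<Rightarrow> real) \<Rightarrow> real \<Rightarrow> bool" where
  "jet_majorized s F F' B \<longleftrightarrow>
     (\<exists>b\<^sub>0\<ge>0. \<exists>b\<^sub>1\<ge>0. \<exists>b\<^sub>2\<ge>0. b\<^sub>0 + b\<^sub>1 + b\<^sub>2 \<le> B \<and>
        (\<forall>u\<in>cball 0 s. linear (F' u) \<and> \<bar>F u\<bar> \<le> b\<^sub>0 \<and>
           (\<forall>h. \<bar>F' u h\<bar> \<le> b\<^sub>1 * (norm h / (2 * s))) \<and>
           (\<forall>w\<in>cball 0 s. \<bar>F w - F u - F' u (w - u)\<bar> \<le> b\<^sub>2 * (norm (w - u) / (2 * s))\<^sup>2)))"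

lemma jet_majorized_mult:
  fixes F G :: "'a::real_normed_vector \<Rightarrow> real"
  assumes "s > 0" and "jet_majorized s F F' B" and "jet_majorized s G G' C"
  shows "jet_majorized s (\<lambda>u. F u * G u) (\<lambda>u h. F u * G' u h + F' u h * G u) (B * C)"
proof -
  obtain b0 b1 b2 where b: "b0 \<ge> 0" "b1 \<ge> 0" "b2 \<ge> 0" "b0 + b1 + b2 \<le> B"
    and F: "\<And>u. u\<in>cball 0 s \<Longrightarrow> linear (F' u)" "\<And>u. u\<in>cball 0 s \<Longrightarrow> \<bar>F u\<bar> \<le> b0"
      "\<And>u h. u\<in>cball 0 s \<Longrightarrow> \<bar>F' u h\<bar> \<le> b1 * (norm h / (2 * s))"
      "\<And>u w. u\<in>cball 0 s \<Longrightarrow> w\<in>cball 0 s \<Longrightarrow> \<bar>F w - F u - F' u (w - u)\<bar> \<le> b2 * (norm (w - u) / (2 * s))\<^sup>2"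
    using assms(2) unfolding jet_majorized_def by blast
  obtain c0 c1 c2 where c: "c0 \<ge> 0" "c1 \<ge> 0" "c2 \<ge> 0" "c0 + c1 + c2 \<le> C"
    and G: "\<And>u. u\<in>cball 0 s \<Longrightarrow> linear (G' u)" "\<And>u. u\<in>cball 0 s \<Longrightarrow> \<bar>G u\<bar> \<le> c0"
      "\<And>u h. u\<in>cball 0 s \<Longrightarrow> \<bar>G' u h\<bar> \<le> c1 * (norm h / (2 * s))"
      "\<And>u w. u\<in>cball 0 s \<Longrightarrow> w\<in>cball 0 s \<Longrightarrow> \<bar>G w - G u - G' u (w - u)\<bar> \<le> c2 * (norm (w - u) / (2 * s))\<^sup>2"
    using assms(3) unfolding jet_majorized_def by blast
  \<comment> \<open>The remainder of the product collects every product of parts of order at least two.\<close>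
  define d2 where "d2 = b0*c2 + b1*c1 + b2*c0 + b1*c2 + b2*c1 + b2*c2"
  have sum: "b0*c0 + (b0*c1+b1*c0) + d2 \<le> B * C"
  proof -
    have "b0*c0 + (b0*c1+b1*c0) + d2 = (b0+b1+b2)*(c0+c1+c2)"
      by (simp add: d2_def algebra_simps)
    also have "\<dots> \<le> B * C" using b c by (intro mult_mono) auto
    finally show ?thesis .
  qed
  have "\<bar>F u * G u\<bar> \<le> b0*c0" if "u \<in> cball 0 s" for u
    unfolding abs_mult using F(2)[OF that] G(2)[OF that] b(1) by (intro mult_mono) auto
  moreover have "\<bar>F u * G' u h + F' u h * G u\<bar> \<le> (b0*c1+b1*c0) * (norm h / (2 * s))"
    if "u \<in> cball 0 s" for u h
  proof -
    have "\<bar>F u * G' u h\<bar> \<le> b0 * (c1 * (norm h / (2 * s)))"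
      unfolding abs_mult using F(2)[OF that] G(3)[OF that, of h] b(1) by (intro mult_mono) auto
    moreover have "\<bar>F' u h * G u\<bar> \<le> b1 * (norm h / (2 * s)) * c0"
      unfolding abs_mult using F(3)[OF that, of h] G(2)[OF that] b(2) c(1) assms(1) by (intro mult_mono) auto
    ultimately have "\<bar>F u * G' u h + F' u h * G u\<bar>
        \<le> b0 * (c1 * (norm h / (2 * s))) + b1 * (norm h / (2 * s)) * c0" by linarith
    also have "\<dots> = (b0*c1+b1*c0) * (norm h / (2 * s))" by (simp only: algebra_simps)
    finally show ?thesis .
  qed
  moreover have "\<bar>F w * G w - F u * G u - (F u * G' u (w-u) + F' u (w-u) * G u)\<bar>
      \<le> d2 * (norm (w - u) / (2 * s))\<^sup>2" if u: "u \<in> cball 0 s" and w: "w \<in> cball 0 s" for u w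
  proof -
    define l where "l = norm (w - u) / (2 * s)"
    have "norm (w - u) \<le> 2 * s"
      using u w norm_triangle_ineq4[of w u] by simp
    then have l: "0 \<le> l" "l \<le> 1" using assms(1) by (auto simp: l_def)
    define p0 p1 p2 where "p0 = F u" and "p1 = F' u (w-u)" and "p2 = F w - F u - F' u (w-u)"
    define q0 q1 q2 where "q0 = G u" and "q1 = G' u (w-u)" and "q2 = G w - G u - G' u (w-u)"
    have p: "\<bar>p0\<bar> \<le> b0" "\<bar>p1\<bar> \<le> b1 * l" "\<bar>p2\<bar> \<le> b2 * l\<^sup>2"
      using F(2)[OF u] F(3)[OF u] F(4)[OF u w] by (simp_all add: p0_def p1_def p2_def l_def)
    have q: "\<bar>q0\<bar> \<le> c0" "\<bar>q1\<bar> \<le> c1 * l" "\<bar>q2\<bar> \<le> c2 * l\<^sup>2"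
      using G(2)[OF u] G(3)[OF u] G(4)[OF u w] by (simp_all add: q0_def q1_def q2_def l_def)
    have m: "\<bar>a * b\<bar> \<le> \<alpha> * \<gamma>" if "\<bar>a\<bar> \<le> \<alpha>" "\<bar>b\<bar> \<le> \<gamma>" for a b \<alpha> \<gamma> :: real
      unfolding abs_mult using that by (intro mult_mono) auto
    have l3: "l^3 \<le> l\<^sup>2" and l4: "l^4 \<le> l\<^sup>2"
      using l by (auto intro: power_decreasing)
    have "\<bar>p0*q2\<bar> \<le> b0*c2*l\<^sup>2" using m[OF p(1) q(3)] by (simp add: ac_simps)
    moreover have "\<bar>p1*q1\<bar> \<le> b1*c1*l\<^sup>2" using m[OF p(2) q(2)] by (simp add: ac_simps power2_eq_square)
    moreover have "\<bar>p2*q0\<bar> \<le> b2*c0*l\<^sup>2" using m[OF p(3) q(1)] by (simp add: ac_simps)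
    moreover have "\<bar>p1*q2\<bar> \<le> b1*c2*l\<^sup>2"
    proof -
      have "\<bar>p1*q2\<bar> \<le> (b1*c2)*l^3" using m[OF p(2) q(3)] by (simp add: ac_simps power2_eq_square power3_eq_cube)
      also have "\<dots> \<le> (b1*c2)*l\<^sup>2" using l3 b c by (intro mult_left_mono) auto
      finally show ?thesis .
    qed
    moreover have "\<bar>p2*q1\<bar> \<le> b2*c1*l\<^sup>2"
    proof -
      have "\<bar>p2*q1\<bar> \<le> (b2*c1)*l^3" using m[OF p(3) q(2)] by (simp add: ac_simps power2_eq_square power3_eq_cube)
      also have "\<dots> \<le> (b2*c1)*l\<^sup>2" using l3 b c by (intro mult_left_mono) auto
      finally show ?thesis .
    qed
    moreover have "\<bar>p2*q2\<bar> \<le> b2*c2*l\<^sup>2"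
    proof -
      have "\<bar>p2*q2\<bar> \<le> (b2*c2)*l^4" using m[OF p(3) q(3)] by (simp add: ac_simps power2_eq_square power4_eq_xxxx)
      also have "\<dots> \<le> (b2*c2)*l\<^sup>2" using l4 b c by (intro mult_left_mono) auto
      finally show ?thesis .
    qed
    moreover have "F w * G w - F u * G u - (F u * G' u (w-u) + F' u (w-u) * G u)
      = p0*q2 + p1*q1 + p2*q0 + p1*q2 + p2*q1 + p2*q2"
      by (simp add: p0_def p1_def p2_def q0_def q1_def q2_def algebra_simps)
    ultimately show ?thesis
      unfolding l_def[symmetric] d2_def by (simp add: algebra_simps abs_le_iff)
  qed
  moreover have "linear (\<lambda>h. F u * G' u h + F' u h * G u)" if "u \<in> cball 0 s" for u
    using F(1)[OF that] G(1)[OF that]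
    by (intro linearI) (simp_all add: linear_add linear_scale algebra_simps)
  moreover have "d2 \<ge> 0" "b0*c1+b1*c0 \<ge> 0" "b0*c0 \<ge> 0" using b c by (auto simp: d2_def)
  ultimately show ?thesis
    using sum unfolding jet_majorized_def by meson
qed

lemma jet_majorized_one: "jet_majorized s (\<lambda>u. 1) (\<lambda>u h. 0) 1"
  unfolding jet_majorized_def
  by (rule exI[of _ 1], simp, rule exI[of _ 0], simp, rule exI[of _ 0], simp add: linear_zero)

text \<open>The value contributes \<open>s\<close>, the linear part \<open>2 * s\<close>. A monomial of exponent \<open>\<nu>\<close> on the ball of radius
  \<open>s\<close> is thus majorized by its own value at the point with all coordinates \<open>3 * s\<close>.\<close>

lemma jet_majorized_coordinate:
  assumes "s > 0"
  shows "jet_majorized s (\<lambda>u. (u :: real ^ 'n::finite) $ i) (\<lambda>u h. h $ i) (3 * s)"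
  unfolding jet_majorized_def
proof (rule exI[of _ s], rule conjI, use assms in simp, rule exI[of _ "2 * s"], rule conjI,
    use assms in simp, rule exI[of _ 0], intro conjI ballI allI)
  fix u :: "real ^ 'n" assume "u \<in> cball 0 s"
  then show "\<bar>u $ i\<bar> \<le> s" using component_le_norm_cart[of u i] by simp
next
  show "\<bar>h $ i\<bar> \<le> 2 * s * (norm h / (2 * s))" for h :: "real ^ 'n"
    using component_le_norm_cart[of h i] assms by simp
qed (auto intro!: linearI)

lemma jet_majorized_power:
  assumes "s > 0" and "jet_majorized s F F' B"
  shows "\<exists>G. jet_majorized s (\<lambda>u. F u ^ k) G (B ^ k)"
proof (induction k)
  case 0
  then show ?case using jet_majorized_one by auto
next
  case (Suc k)
  then show ?case using jet_majorized_mult[OF assms] by auto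
qed

lemma jet_majorized_monomial:
  assumes "s > 0"
  shows "\<exists>G. jet_majorized s (\<lambda>u :: real ^ 'n::finite. \<Prod>i\<in>I. u $ i ^ \<nu> i) G (\<Prod>i\<in>I. (3 * s) ^ \<nu> i)"
proof (induction I rule: infinite_finite_induct)
  case (insert i I)
  obtain G\<^sub>1 where G\<^sub>1: "jet_majorized s (\<lambda>u :: real ^ 'n. u $ i ^ \<nu> i) G\<^sub>1 ((3 * s) ^ \<nu> i)"
    using jet_majorized_power[OF assms jet_majorized_coordinate[OF assms]] by blast
  obtain G\<^sub>2 where G\<^sub>2: "jet_majorized s (\<lambda>u :: real ^ 'n. \<Prod>i\<in>I. u $ i ^ \<nu> i) G\<^sub>2
      (\<Prod>i\<in>I. (3 * s) ^ \<nu> i)"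
    using insert.IH by blast
  from jet_majorized_mult[OF assms G\<^sub>1 G\<^sub>2] show ?case using insert.hyps by auto
qed (use jet_majorized_one in auto)

lemma jet_majorizedD:
  fixes F :: "'a::real_normed_vector \<Rightarrow> real"
  assumes "s > 0" and "jet_majorized s F F' B" and "u \<in> cball 0 s"
  shows "linear (F' u)" and "\<bar>F' u h\<bar> \<le> B * (norm h / (2 * s))"
    and "w \<in> cball 0 s \<Longrightarrow> \<bar>F w - F u - F' u (w - u)\<bar> \<le> B * (norm (w - u) / (2 * s))\<^sup>2"
proof -
  obtain b0 b1 b2 where b: "b0 \<ge> 0" "b1 \<ge> 0" "b2 \<ge> 0" "b0 + b1 + b2 \<le> B"
    and F: "linear (F' u)" 
      "\<And>h. \<bar>F' u h\<bar> \<le> b1 * (norm h / (2 * s))"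
      "\<And>w. w\<in>cball 0 s \<Longrightarrow> \<bar>F w - F u - F' u (w - u)\<bar> \<le> b2 * (norm (w - u) / (2 * s))\<^sup>2"
    using assms(2,3) unfolding jet_majorized_def by blast
  show "linear (F' u)" by (rule F)
  have "b1 * (norm h / (2 * s)) \<le> B * (norm h / (2 * s))"
    using b assms(1) by (intro mult_right_mono) auto
  then show "\<bar>F' u h\<bar> \<le> B * (norm h / (2 * s))" using F(2) order_trans by blast
  have "b2 * (norm (w - u) / (2 * s))\<^sup>2 \<le> B * (norm (w - u) / (2 * s))\<^sup>2"
    using b by (intro mult_right_mono) auto
  then show "\<bar>F w - F u - F' u (w - u)\<bar> \<le> B * (norm (w - u) / (2 * s))\<^sup>2" if "w \<in> cball 0 s"
    using F(3)[OF that] by linarith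
qed

lemma has_sum_abs_le:
  fixes g :: "'i \<Rightarrow> real"
  assumes "(g has_sum a) A" and "(b has_sum c) A" and "\<And>i. i \<in> A \<Longrightarrow> \<bar>g i\<bar> \<le> b i"
  shows "\<bar>a\<bar> \<le> c"
proof -
  have "a \<le> c" using assms by (intro has_sum_mono[of g A a b c]) (auto simp: abs_le_iff)
  moreover have "- a \<le> c"
    using assms by (intro has_sum_mono[of "\<lambda>i. - g i" A "-a" b c]) (auto simp: abs_le_iff has_sum_uminus)
  ultimately show ?thesis by simp
qed

text \<open>Majorizing each monomial turns termwise estimation into absolute convergence of the series at the
  single point with all coordinates \<open>3 * s\<close> away from the centre, and \<open>s\<close> is chosen so small that this
  point lies in the ball of convergence.\<close>

lemma power_series_quadratic_expansion:
  fixes f :: "real ^ 'n::finite \<Rightarrow> real" and a :: "('n \<Rightarrow> nat) \<Rightarrow> real"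
  assumes "r > 0"
    and sum: "\<And>y. y \<in> ball x r \<Longrightarrow>
        ((\<lambda>\<nu>. a \<nu> * (\<Prod>i\<in>UNIV. (y $ i - x $ i) ^ \<nu> i)) has_sum f y) UNIV"
  shows "\<exists>s>0. \<exists>K. \<exists>f'. quadratic_expansion f f' (ball x s) K"
proof -
  define s where "s = r / (6 * (1 + real CARD('n)))"
  have s: "s > 0" using assms(1) by (simp add: s_def add_pos_nonneg)
  define B where "B \<nu> = \<bar>a \<nu>\<bar> * (\<Prod>i\<in>UNIV. (3 * s) ^ \<nu> i)" for \<nu> :: "'n \<Rightarrow> nat"
  have s1: "6 * s * (1 + real CARD('n)) = r" unfolding s_def by (simp add: field_simps)
  have s2: "3 * s * real CARD('n) < r" and sr: "s < r"
  proof -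
    have "0 \<le> s * real CARD('n)" using s by simp
    moreover have "6 * s + 6 * (s * real CARD('n)) = r" using s1 by (simp add: algebra_simps)
    ultimately show "3 * s * real CARD('n) < r" "s < r" using s by linarith+
  qed
  have "B summable_on UNIV"
  proof -
    let ?y = "x + (\<chi> i. 3 * s)"
    have "norm (\<chi> i. 3 * s :: real ^ 'n) \<le> (\<Sum>i\<in>UNIV. \<bar>(\<chi> i. 3 * s :: real ^ 'n) $ i\<bar>)"
      by (rule norm_le_l1_cart)
    also have "\<dots> = 3 * s * real CARD('n)" using s by simp
    finally have "?y \<in> ball x r" using s2 by (simp add: dist_norm)
    from sum[OF this] have "(\<lambda>\<nu>. a \<nu> * (\<Prod>i\<in>UNIV. (3 * s) ^ \<nu> i)) summable_on UNIV"
      by (auto simp: summable_on_def)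
    then have "(\<lambda>\<nu>. norm (a \<nu> * (\<Prod>i\<in>UNIV. (3 * s) ^ \<nu> i))) summable_on UNIV"
      by (rule summable_on_iff_abs_summable_on_real[THEN iffD1])
    moreover have "norm (a \<nu> * (\<Prod>i\<in>UNIV. (3 * s) ^ \<nu> i)) = B \<nu>" for \<nu>
      using s by (simp add: B_def abs_mult prod_nonneg)
    ultimately show ?thesis by simp
  qed
  then obtain A where A: "(B has_sum A) UNIV" by (auto simp: summable_on_def)
  have "\<forall>\<nu>. \<exists>G. jet_majorized s (\<lambda>u :: real ^ 'n. \<Prod>i\<in>UNIV. u $ i ^ \<nu> i) G (\<Prod>i\<in>UNIV. (3 * s) ^ \<nu> i)"
    using jet_majorized_monomial[OF s] by blast
  from choice[OF this] obtain G where
    "\<forall>\<nu>. jet_majorized s (\<lambda>u :: real ^ 'n. \<Prod>i\<in>UNIV. u $ i ^ \<nu> i) (G \<nu>) (\<Prod>i\<in>UNIV. (3 * s) ^ \<nu> i)" ..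
  then have G: "jet_majorized s (\<lambda>u :: real ^ 'n. \<Prod>i\<in>UNIV. u $ i ^ \<nu> i) (G \<nu>)
      (\<Prod>i\<in>UNIV. (3 * s) ^ \<nu> i)" for \<nu> ..
  note GD = jet_majorizedD[OF s G]
  define f' where "f' y h = (\<Sum>\<^sub>\<infinity>\<nu>. a \<nu> * G \<nu> (y - x) h)" for y h
  have bd: "\<bar>a \<nu> * G \<nu> u h\<bar> \<le> B \<nu> * (norm h / (2 * s))" if "u \<in> cball 0 s" for u h \<nu>
    using mult_left_mono[OF GD(2)[OF that, of \<nu> h], of "\<bar>a \<nu>\<bar>"] by (simp add: B_def abs_mult ac_simps)
  have Ac: "((\<lambda>\<nu>. B \<nu> * c) has_sum A * c) UNIV" for c
    by (rule has_sum_cmult_left[OF A])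
  have f': "((\<lambda>\<nu>. a \<nu> * G \<nu> (y - x) h) has_sum f' y h) UNIV" if "y \<in> cball x s" for y h
  proof -
    have "y - x \<in> cball 0 s" using that by (simp add: dist_norm norm_minus_commute)
    note bd = bd[OF this]
    have "(\<lambda>\<nu>. norm (a \<nu> * G \<nu> (y - x) h)) summable_on UNIV"
      by (rule summable_on_comparison_test[of "\<lambda>\<nu>. B \<nu> * (norm h / (2 * s))"])
        (simp_all only: has_sum_imp_summable[OF Ac] real_norm_def bd abs_ge_zero)
    then have "(\<lambda>\<nu>. a \<nu> * G \<nu> (y - x) h) summable_on UNIV"
      by (rule summable_on_iff_abs_summable_on_real[THEN iffD2])
    then show ?thesis unfolding f'_def by (rule has_sum_infsum)
  qed
  define K where "K = max (A / (2 * s)) (A / (2 * s)\<^sup>2)"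
  have "quadratic_expansion f f' (ball x s) K"
    unfolding quadratic_expansion_def
  proof (intro ballI conjI allI)
    fix y assume y: "y \<in> ball x s"
    have ys: "y - x \<in> cball 0 s" "y \<in> cball x s" "y \<in> ball x r"
      using y sr by (auto simp: dist_norm norm_minus_commute)
    show "linear (f' y)"
    proof (rule linearI)
      fix h k
      have "((\<lambda>\<nu>. a \<nu> * G \<nu> (y - x) h + a \<nu> * G \<nu> (y - x) k) has_sum f' y h + f' y k) UNIV"
        by (intro has_sum_add f' ys)
      then have "((\<lambda>\<nu>. a \<nu> * G \<nu> (y - x) (h + k)) has_sum f' y h + f' y k) UNIV"
        by (simp only: linear_add[OF GD(1)[OF ys(1)]] distrib_left)
      then show "f' y (h + k) = f' y h + f' y k"
        by (rule has_sum_unique[OF f'[OF ys(2)]])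
    next
      fix t h
      have "((\<lambda>\<nu>. t * (a \<nu> * G \<nu> (y - x) h)) has_sum t * f' y h) UNIV"
        by (intro has_sum_cmult_right f' ys)
      then have "((\<lambda>\<nu>. a \<nu> * G \<nu> (y - x) (t *\<^sub>R h)) has_sum t * f' y h) UNIV"
        by (simp only: linear_scale[OF GD(1)[OF ys(1)]] real_scaleR_def mult.left_commute)
      then show "f' y (t *\<^sub>R h) = t *\<^sub>R f' y h"
        unfolding real_scaleR_def by (rule has_sum_unique[OF f'[OF ys(2)]])
    qed
    show "norm (f' y h) \<le> K * norm h" for h
    proof -
      have "\<bar>f' y h\<bar> \<le> A * (norm h / (2 * s))"
        by (rule has_sum_abs_le[OF f'[OF ys(2)] Ac]) (use bd[OF ys(1)] in auto)
      also have "\<dots> = A / (2 * s) * norm h" by simp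
      also have "\<dots> \<le> K * norm h" unfolding K_def by (intro mult_right_mono) auto
      finally show ?thesis by simp
    qed
    fix w assume w: "w \<in> ball x s"
    have ws: "w - x \<in> cball 0 s" "w \<in> cball x s" "w \<in> ball x r"
      using w sr by (auto simp: dist_norm norm_minus_commute)
    let ?m = "\<lambda>\<nu> y. \<Prod>i\<in>UNIV. ((y::real^'n) $ i - x $ i) ^ \<nu> i"
    have hs: "((\<lambda>\<nu>. a \<nu> * ?m \<nu> w - a \<nu> * ?m \<nu> y - a \<nu> * G \<nu> (y - x) (w - y))
       has_sum f w - f y - f' y (w - y)) UNIV"
      unfolding diff_conv_add_uminus[of _ "a _ * _"] diff_conv_add_uminus[of _ "f _"] diff_conv_add_uminus[of _ "f' _ _"]
      by (intro has_sum_add has_sum_uminusI sum f' ys ws)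
    have "\<bar>f w - f y - f' y (w - y)\<bar> \<le> A * (norm (w - y) / (2 * s))\<^sup>2"
    proof (rule has_sum_abs_le[OF hs Ac])
      fix \<nu> :: "'n \<Rightarrow> nat"
      have "\<bar>?m \<nu> w - ?m \<nu> y - G \<nu> (y - x) (w - y)\<bar>
          \<le> (\<Prod>i\<in>UNIV. (3 * s) ^ \<nu> i) * (norm (w - y) / (2 * s))\<^sup>2"
        using GD(3)[OF ys(1) ws(1), of \<nu>] by simp
      from mult_left_mono[OF this, of "\<bar>a \<nu>\<bar>"]
      show "\<bar>a \<nu> * ?m \<nu> w - a \<nu> * ?m \<nu> y - a \<nu> * G \<nu> (y - x) (w - y)\<bar>
        \<le> B \<nu> * (norm (w - y) / (2 * s))\<^sup>2"
        by (simp add: B_def abs_mult[symmetric] right_diff_distrib mult.assoc)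
    qed
    also have "\<dots> = A / (2 * s)\<^sup>2 * (norm (w - y))\<^sup>2" by (simp add: power_divide)
    also have "\<dots> \<le> K * (norm (w - y))\<^sup>2" unfolding K_def by (intro mult_right_mono) auto
    finally show "norm (f w - f y - f' y (w - y)) \<le> K * (norm (w - y))\<^sup>2" by simp
  qed
  then show ?thesis using s by blast
qed

lemma grad_unique:
  assumes "GDERIV f x :> v" shows "grad f x = v"
  unfolding grad_def
proof (rule the_equality)
  show "GDERIV f x :> v" by (rule assms)
next
  fix w assume "GDERIV f x :> w"
  then have "(\<lambda>h. h \<bullet> w) = (\<lambda>h. h \<bullet> v)"
    using assms unfolding gderiv_def by (rule has_derivative_unique)
  then show "w = v" by (metis vector_eq_ldot)
qed

lemma real_analytic_quadratic_expansion:
  fixes f :: "real ^ 'n::finite \<Rightarrow> real"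
  assumes "real_analytic_on f D" and "p \<in> D"
  shows "\<exists>r>0. \<exists>K. quadratic_expansion f (\<lambda>u h. grad f u \<bullet> h) (ball p r) K"
proof -
  obtain r a where "r > 0" and "\<And>y. y \<in> ball p r \<Longrightarrow>
        ((\<lambda>\<nu>. a \<nu> * (\<Prod>i\<in>UNIV. (y $ i - p $ i) ^ \<nu> i)) has_sum f y) UNIV"
    using assms unfolding real_analytic_on_def by blast
  then obtain s K f' where s: "s > 0" and q: "quadratic_expansion f f' (ball p s) K"
    using power_series_quadratic_expansion by blast
  have "f' u h = grad f u \<bullet> h" if u: "u \<in> ball p s" for u h
  proof -
    have l: "linear (f' u)" using quadratic_expansionD(1)[OF q u] .
    have adj: "f' u h = h \<bullet> adjoint (f' u) 1" for h
      using adjoint_works[OF l, of h 1] by simp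
    have "GDERIV f u :> adjoint (f' u) 1"
      unfolding gderiv_def using quadratic_expansion_has_derivative[OF q _ u] adj
      by (metis (no_types, lifting) ext open_ball)
    then show ?thesis using adj grad_unique by (metis inner_commute)
  qed
  with q have "quadratic_expansion f (\<lambda>u h. grad f u \<bullet> h) (ball p s) K"
    unfolding quadratic_expansion_def by (auto simp: inner_add_right intro!: linearI)
  then show ?thesis using s by blast
qed

section \<open>Smooth maps and slice charts\<close>

lemma linear_norm_le_Basis:
  fixes L :: "'a::euclidean_space \<Rightarrow> 'b::real_normed_vector"
  assumes "linear L" and "\<And>b. b \<in> Basis \<Longrightarrow> norm (L b) \<le> C b"
  shows "norm (L h) \<le> (\<Sum>b\<in>Basis. C b) * norm h"
proof -
  have "L h = L (\<Sum>b\<in>Basis. (h \<bullet> b) *\<^sub>R b)" by (simp add: euclidean_representation)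
  also have "\<dots> = (\<Sum>b\<in>Basis. (h \<bullet> b) *\<^sub>R L b)"
    by (simp add: linear_sum[OF assms(1)] linear_scale[OF assms(1)])
  also have "norm \<dots> \<le> (\<Sum>b\<in>Basis. C b * norm h)"
  proof (rule sum_norm_le)
    fix b :: 'a assume b: "b \<in> Basis"
    have "\<bar>h \<bullet> b\<bar> * norm (L b) \<le> norm h * C b"
      using b assms(2)[OF b] Basis_le_norm[OF b, of h] by (intro mult_mono) auto
    then show "norm ((h \<bullet> b) *\<^sub>R L b) \<le> C b * norm h" by (simp add: mult.commute)
  qed
  finally show ?thesis by (simp add: sum_distrib_right)
qed

text \<open>The partial derivatives are continuous, hence bounded on a compact ball, and the mean value
  inequality applies there.\<close>

lemma C1_locally_Lipschitz:
  fixes g :: "'a::euclidean_space \<Rightarrow> 'b::euclidean_space"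
  assumes C1: "Ck_map (Suc 0) g U" and "open U" and "p \<in> U"
  shows "\<exists>r>0. \<exists>B\<ge>0. \<forall>u\<in>ball p r. \<forall>w\<in>ball p r. norm (g w - g u) \<le> B * norm (w - u)"
proof -
  obtain r where r: "r > 0" "cball p r \<subseteq> U"
    using assms(2,3) open_contains_cball by blast
  have diff: "(g has_derivative frechet_derivative g (at u)) (at u)" if "u \<in> U" for u
    using C1 that by (simp add: frechet_derivative_works)
  have "\<exists>C. \<forall>u\<in>cball p r. norm (frechet_derivative g (at u) v) \<le> C" for v
  proof -
    have "continuous_on (cball p r) (\<lambda>u. frechet_derivative g (at u) v)"
      using C1 r(2) by (auto intro: continuous_on_subset)
    then have "bounded ((\<lambda>u. frechet_derivative g (at u) v) ` cball p r)"
      by (intro compact_imp_bounded compact_continuous_image compact_cball)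
    then show ?thesis by (auto simp: bounded_iff)
  qed
  then obtain C where C: "\<And>v u. u \<in> cball p r \<Longrightarrow> norm (frechet_derivative g (at u) v) \<le> C v"
    by metis
  define B where "B = max 0 (\<Sum>b\<in>Basis. C b)"
  have "norm (g w - g u) \<le> B * norm (w - u)" if "u \<in> ball p r" "w \<in> ball p r" for u w
  proof (rule differentiable_bound[where f' = "\<lambda>z. frechet_derivative g (at z)" and S = "ball p r"])
    fix z assume z: "z \<in> ball p r"
    then have zU: "z \<in> U" "z \<in> cball p r" using r(2) by auto
    show "(g has_derivative frechet_derivative g (at z)) (at z within ball p r)"
      using diff[OF zU(1)] by (rule has_derivative_at_withinI)
    have lin: "linear (frechet_derivative g (at z))"
      using diff[OF zU(1)] by (rule has_derivative_linear)
    show "onorm (frechet_derivative g (at z)) \<le> B"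
    proof (rule onorm_bound)
      show "norm (frechet_derivative g (at z) h) \<le> B * norm h" for h
        by (rule order_trans[OF linear_norm_le_Basis[OF lin C[OF zU(2)]]])
          (auto simp: B_def intro: mult_right_mono)
    qed (simp add: B_def)
  qed (use that in auto)
  then show ?thesis using r(1) by (intro exI[of _ r] conjI exI[of _ B]) (auto simp: B_def)
qed

text \<open>The partial derivatives are locally Lipschitz, hence so is the derivative in operator norm. The
  mean value inequality for \<open>z \<mapsto> g z - g' u z\<close> on the segment from \<open>u\<close> to \<open>w\<close> then gives the remainder.\<close>

lemma C2_quadratic_expansion:
  fixes g :: "'a::euclidean_space \<Rightarrow> 'b::euclidean_space"
  assumes C2: "Ck_map (Suc (Suc 0)) g U" and "open U" and "p \<in> U"
  shows "\<exists>r>0. \<exists>K. ball p r \<subseteq> U \<and> quadratic_expansion g (\<lambda>u. frechet_derivative g (at u)) (ball p r) K"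
proof -
  define Dg where "Dg u = frechet_derivative g (at u)" for u
  have "\<forall>b\<in>Basis. \<exists>r. r > 0 \<and> (\<exists>B. B \<ge> 0 \<and> (\<forall>u\<in>ball p r. \<forall>w\<in>ball p r. norm (Dg w b - Dg u b) \<le> B * norm (w - u)))"
    using C1_locally_Lipschitz[OF _ assms(2,3)] C2 unfolding Dg_def by (metis Ck_map.simps(2))
  then obtain \<rho> L where \<rho>: "\<And>b. b \<in> Basis \<Longrightarrow> \<rho> b > 0"
    and L: "\<And>b. b \<in> Basis \<Longrightarrow> L b \<ge> 0" "\<And>b u w. b \<in> Basis \<Longrightarrow> u \<in> ball p (\<rho> b) \<Longrightarrow> w \<in> ball p (\<rho> b) \<Longrightarrow>
        norm (Dg w b - Dg u b) \<le> L b * norm (w - u)"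
    by metis
  obtain r0 where r0: "r0 > 0" "ball p r0 \<subseteq> U"
    using assms(2,3) open_contains_ball by blast
  define r where "r = Min (insert r0 (\<rho> ` Basis))"
  have r: "r > 0" using r0 \<rho> by (auto simp: r_def)
  have rr: "r \<le> r0" and r\<rho>: "\<And>b. b \<in> Basis \<Longrightarrow> r \<le> \<rho> b"
    unfolding r_def by (rule Min_le; simp)+
  have rU: "ball p r \<subseteq> U" using r0 rr subset_ball by blast
  have diff: "(g has_derivative Dg u) (at u)" if "u \<in> ball p r" for u
    using C2 rU that unfolding Dg_def by (auto simp: frechet_derivative_works)
  note lin = has_derivative_linear[OF diff]
  define B where "B = (\<Sum>b\<in>Basis. L b)"
  have B: "B \<ge> 0" using L by (simp add: B_def sum_nonneg)
  have lip: "norm (Dg w h - Dg u h) \<le> B * norm (w - u) * norm h"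
    if "u \<in> ball p r" "w \<in> ball p r" for u w h
  proof -
    have "norm ((\<lambda>h. Dg w h - Dg u h) h) \<le> (\<Sum>b\<in>Basis. L b * norm (w - u)) * norm h"
      using that r\<rho> by (intro linear_norm_le_Basis linear_compose_sub lin L) force+
    then show ?thesis by (simp add: B_def sum_distrib_right)
  qed
  define K where "K = onorm (Dg p) + B * r + B"
  have p: "p \<in> ball p r" using r by simp
  have bl: "bounded_linear (Dg p)" using diff[OF p] by (rule has_derivative_bounded_linear)
  have BK: "B \<le> K" using onorm_pos_le[OF bl] B r by (simp add: K_def)
  have "quadratic_expansion g Dg (ball p r) K"
    unfolding quadratic_expansion_def
  proof (intro ballI conjI allI)
    fix u assume u: "u \<in> ball p r"
    show "linear (Dg u)" using lin[OF u] .
    show "norm (Dg u h) \<le> K * norm h" for h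
    proof -
      have "norm (Dg u h) \<le> norm (Dg p h) + norm (Dg u h - Dg p h)"
        using norm_triangle_ineq[of "Dg p h" "Dg u h - Dg p h"] by simp
      also have "norm (Dg p h) \<le> onorm (Dg p) * norm h" by (rule onorm[OF bl])
      also have "norm (Dg u h - Dg p h) \<le> B * norm (u - p) * norm h" by (rule lip[OF p u])
      also have "B * norm (u - p) * norm h \<le> B * r * norm h"
        using u B by (intro mult_right_mono mult_left_mono) (auto simp: dist_norm norm_minus_commute)
      finally have "norm (Dg u h) \<le> onorm (Dg p) * norm h + B * r * norm h" by simp
      also have "\<dots> \<le> K * norm h" using B by (simp add: K_def algebra_simps)
      finally show ?thesis .
    qed
    fix w assume w: "w \<in> ball p r"
    have seg: "closed_segment u w \<subseteq> ball p r"
      using u w by (simp add: closed_segment_subset)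
    have "norm ((g w - Dg u w) - (g u - Dg u u)) \<le> B * norm (w - u) * norm (w - u)"
    proof (rule differentiable_bound[where f' = "\<lambda>z h. Dg z h - Dg u h" and S = "closed_segment u w"])
      fix z assume z: "z \<in> closed_segment u w"
      then have zr: "z \<in> ball p r" using seg by auto
      have Du: "(Dg u has_derivative Dg u) (at z)"
        by (rule bounded_linear_imp_has_derivative[OF has_derivative_bounded_linear[OF diff[OF u]]])
      show "((\<lambda>z. g z - Dg u z) has_derivative (\<lambda>h. Dg z h - Dg u h)) (at z within closed_segment u w)"
        by (rule has_derivative_at_withinI[OF has_derivative_diff[OF diff[OF zr] Du]])
      show "onorm (\<lambda>h. Dg z h - Dg u h) \<le> B * norm (w - u)"
      proof (rule onorm_bound)
        fix h :: 'a
        have "norm (z - u) \<le> norm (w - u)"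
          using segment_bound1[OF z] .
        then have "B * norm (z - u) * norm h \<le> B * norm (w - u) * norm h"
          using B by (intro mult_right_mono mult_left_mono) auto
        then show "norm (Dg z h - Dg u h) \<le> B * norm (w - u) * norm h"
          using lip[OF u zr, of h] by linarith
      qed (use B in simp)
    qed auto
    also have "(g w - Dg u w) - (g u - Dg u u) = g w - g u - Dg u (w - u)"
      by (simp add: linear_diff[OF lin[OF u]])
    also have "B * norm (w - u) * norm (w - u) \<le> K * (norm (w - u))\<^sup>2"
      unfolding power2_eq_square mult.assoc using BK by (intro mult_right_mono) auto
    finally show "norm (g w - g u - Dg u (w - u)) \<le> K * (norm (w - u))\<^sup>2" .
  qed
  then show ?thesis using r rU unfolding Dg_def by blast
qed

lemma tangent_cone_Int_open:
  assumes "open O'" and "x \<in> O'"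
  shows "tangent_cone (M \<inter> O') x = tangent_cone M x"
proof
  show "tangent_cone (M \<inter> O') x \<subseteq> tangent_cone M x"
    unfolding tangent_cone_def by blast
  show "tangent_cone M x \<subseteq> tangent_cone (M \<inter> O') x"
  proof
    fix \<xi> assume "\<xi> \<in> tangent_cone M x"
    then obtain y a where y: "\<And>j. y j \<in> M" "\<And>j. a j > 0" "y \<longlonglongrightarrow> x"
      "(\<lambda>j. a j *\<^sub>R (y j - x)) \<longlonglongrightarrow> \<xi>"
      unfolding tangent_cone_def by blast
    obtain k where k: "\<And>j. j \<ge> k \<Longrightarrow> y j \<in> O'"
      using topological_tendstoD[OF y(3) assms] unfolding eventually_sequentially by blast
    show "\<xi> \<in> tangent_cone (M \<inter> O') x"
      unfolding tangent_cone_def mem_Collect_eq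
    proof (intro exI conjI allI)
      show "y (j + k) \<in> M \<inter> O'" for j using y(1) k by simp
      show "a (j + k) > 0" for j by (rule y)
      show "(\<lambda>j. y (j + k)) \<longlonglongrightarrow> x" using y(3) by (rule LIMSEQ_ignore_initial_segment)
      show "(\<lambda>j. a (j + k) *\<^sub>R (y (j + k) - x)) \<longlonglongrightarrow> \<xi>"
        using LIMSEQ_ignore_initial_segment[OF y(4)] .
    qed
  qed
qed

text \<open>The inverse of \<open>\<phi>\<close> parametrizes \<open>S\<close> near a point by an open piece of the linear space \<open>L\<close>. The tangent
  cones of \<open>S\<close> are then the images of \<open>L\<close> under the derivatives of \<open>\<psi>\<close>.\<close>

locale slice_chart =
  fixes S U V :: "(real ^ 'n::finite) set" and \<phi> \<psi> :: "real ^ 'n \<Rightarrow> real ^ 'n" and L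
  assumes open_U: "open U" and open_V: "open V"
    and homeo: "homeomorphism U V \<phi> \<psi>"
    and smooth_\<phi>: "smooth_map \<phi> U" and smooth_\<psi>: "smooth_map \<psi> V"
    and subspace_L: "subspace L" and slice: "\<phi> ` (S \<inter> U) = V \<inter> L"
begin

definition "D\<phi> x = frechet_derivative \<phi> (at x)"
definition "D\<psi> u = frechet_derivative \<psi> (at u)"

lemma \<phi>_expansion:
  assumes "x \<in> U" shows "\<exists>r>0. \<exists>K. ball x r \<subseteq> U \<and> quadratic_expansion \<phi> D\<phi> (ball x r) K"
  using C2_quadratic_expansion[OF _ open_U assms] smooth_\<phi>
  unfolding D\<phi>_def[abs_def] smooth_map_def by blast

lemma \<psi>_expansion:
  assumes "u \<in> V" shows "\<exists>r>0. \<exists>K. ball u r \<subseteq> V \<and> quadratic_expansion \<psi> D\<psi> (ball u r) K"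
  using C2_quadratic_expansion[OF _ open_V assms] smooth_\<psi>
  unfolding D\<psi>_def[abs_def] smooth_map_def by blast

lemma \<psi>_\<phi>: "x \<in> U \<Longrightarrow> \<psi> (\<phi> x) = x" and \<phi>_in_V: "x \<in> U \<Longrightarrow> \<phi> x \<in> V"
  using homeo by (auto simp: homeomorphism_def)

lemma \<phi>_in_L: "x \<in> S \<Longrightarrow> x \<in> U \<Longrightarrow> \<phi> x \<in> L"
  using slice by blast

lemma \<psi>_in_S: "u \<in> V \<Longrightarrow> u \<in> L \<Longrightarrow> \<psi> u \<in> S"
proof -
  assume "u \<in> V" "u \<in> L"
  then obtain m where "m \<in> S" "m \<in> U" "u = \<phi> m" using slice by blast
  then show "\<psi> u \<in> S" by (simp add: \<psi>_\<phi>)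
qed

lemma D\<psi>_D\<phi>:
  assumes "x \<in> U" shows "D\<psi> (\<phi> x) (D\<phi> x h) = h"
proof -
  obtain r K where "r > 0" "quadratic_expansion \<phi> D\<phi> (ball x r) K" using \<phi>_expansion[OF assms] by blast
  then have 1: "(\<phi> has_derivative D\<phi> x) (at x)"
    using quadratic_expansion_has_derivative by fastforce
  obtain r K where "r > 0" "quadratic_expansion \<psi> D\<psi> (ball (\<phi> x) r) K"
    using \<psi>_expansion[OF \<phi>_in_V[OF assms]] by blast
  then have 2: "(\<psi> has_derivative D\<psi> (\<phi> x)) (at (\<phi> x))"
    using quadratic_expansion_has_derivative by fastforce
  have "((\<lambda>x. \<psi> (\<phi> x)) has_derivative (\<lambda>h. D\<psi> (\<phi> x) (D\<phi> x h))) (at x)"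
    using has_derivative_compose[OF 1 2] .
  then have "((\<lambda>x. x) has_derivative (\<lambda>h. D\<psi> (\<phi> x) (D\<phi> x h))) (at x)"
    by (rule has_derivative_transform_within_open[OF _ open_U assms \<psi>_\<phi>])
  then have "(\<lambda>h. D\<psi> (\<phi> x) (D\<phi> x h)) = (\<lambda>h. h)"
    using has_derivative_ident by (rule has_derivative_unique)
  then show ?thesis by metis
qed

text \<open>Rescaled differences of points of \<open>S\<close> are mapped by \<open>\<phi>\<close>, up to a vanishing error, to vectors of \<open>L\<close>,
  and \<open>L\<close> is closed.\<close>

lemma D\<phi>_tangent:
  assumes "x \<in> S" and "x \<in> U" and "\<xi> \<in> tangent_cone S x"
  shows "D\<phi> x \<xi> \<in> L"
proof -
  obtain r K where r: "r > 0" "ball x r \<subseteq> U" and q: "quadratic_expansion \<phi> D\<phi> (ball x r) K"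
    using \<phi>_expansion[OF assms(2)] by blast
  have x: "x \<in> ball x r" using r by simp
  have "\<xi> \<in> tangent_cone (S \<inter> ball x r) x"
    using assms(3) tangent_cone_Int_open[of "ball x r" x S] x by simp
  then obtain y a where y: "\<And>j. y j \<in> S \<inter> ball x r" "\<And>j. a j > 0" "y \<longlonglongrightarrow> x"
      "(\<lambda>j. a j *\<^sub>R (y j - x)) \<longlonglongrightarrow> \<xi>"
    unfolding tangent_cone_def by blast
  note D = quadratic_expansionD[OF q x]
  have bl: "bounded_linear (D\<phi> x)" using D(1) by (simp add: linear_conv_bounded_linear)
  define e where "e j = \<phi> (y j) - \<phi> x - D\<phi> x (y j - x)" for j
  have e0: "(\<lambda>j. a j *\<^sub>R e j) \<longlonglongrightarrow> 0"
  proof (rule Lim_null_comparison)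
    show "\<forall>\<^sub>F j in sequentially. norm (a j *\<^sub>R e j) \<le> K * norm (a j *\<^sub>R (y j - x)) * norm (y j - x)"
    proof (rule always_eventually, rule allI)
      fix j
      have "norm (e j) \<le> K * (norm (y j - x))\<^sup>2" unfolding e_def using D(3) y(1) by blast
      from mult_left_mono[OF this, of "a j"]
      show "norm (a j *\<^sub>R e j) \<le> K * norm (a j *\<^sub>R (y j - x)) * norm (y j - x)"
        using y(2)[of j] by (simp add: power2_eq_square ac_simps)
    qed
    have "(\<lambda>j. K * norm (a j *\<^sub>R (y j - x)) * norm (y j - x)) \<longlonglongrightarrow> K * norm \<xi> * norm (x - x)"
      by (intro tendsto_intros y)
    then show "(\<lambda>j. K * norm (a j *\<^sub>R (y j - x)) * norm (y j - x)) \<longlonglongrightarrow> 0" by simp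
  qed
  have "(\<lambda>j. D\<phi> x (a j *\<^sub>R (y j - x)) + a j *\<^sub>R e j) \<longlonglongrightarrow> D\<phi> x \<xi> + 0"
    by (intro tendsto_add e0 bounded_linear.tendsto[OF bl] y)
  moreover have "D\<phi> x (a j *\<^sub>R (y j - x)) + a j *\<^sub>R e j = a j *\<^sub>R (\<phi> (y j) - \<phi> x)" for j
    by (simp only: e_def linear_scale[OF D(1)] flip: scaleR_add_right) simp
  ultimately have lim: "(\<lambda>j. a j *\<^sub>R (\<phi> (y j) - \<phi> x)) \<longlonglongrightarrow> D\<phi> x \<xi>" by simp
  have "a j *\<^sub>R (\<phi> (y j) - \<phi> x) \<in> L" for j
    using y(1)[of j] r(2) assms(1,2) by (intro subspace_scale subspace_diff subspace_L \<phi>_in_L) auto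
  then show ?thesis
    using closed_sequentially[OF closed_subspace[OF subspace_L] _ lim] by blast
qed

text \<open>The sequence \<open>\<psi> (u + t\<^sub>j w)\<close> with \<open>t\<^sub>j\<close> tending to zero lies in \<open>S\<close> and realizes the tangent vector.\<close>

lemma D\<psi>_tangent:
  assumes "u \<in> V" and "u \<in> L" and "w \<in> L"
  shows "D\<psi> u w \<in> tangent_cone S (\<psi> u)"
proof -
  obtain r K where r: "r > 0" "ball u r \<subseteq> V" and q: "quadratic_expansion \<psi> D\<psi> (ball u r) K"
    using \<psi>_expansion[OF assms(1)] by blast
  have u: "u \<in> ball u r" using r by simp
  note D = quadratic_expansionD[OF q u]
  define \<delta> where "\<delta> = r / (1 + norm w)"
  have \<delta>: "\<delta> > 0" using r by (simp add: \<delta>_def add_pos_nonneg)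
  define t where "t j = \<delta> / real (Suc j)" for j
  have t: "t j > 0" for j using \<delta> by (simp add: t_def)
  have t0: "t \<longlonglongrightarrow> 0"
    unfolding t_def using LIMSEQ_inverse_real_of_nat tendsto_mult_right_zero[of "\<lambda>j. inverse (real (Suc j))" _ \<delta>]
    by (simp add: divide_inverse)
  have tw: "u + t j *\<^sub>R w \<in> ball u r" for j
  proof -
    have "t j \<le> \<delta>" using \<delta> by (simp add: t_def divide_le_eq)
    then have "t j * norm w \<le> \<delta> * norm w" by (intro mult_right_mono) auto
    also have "\<dots> < \<delta> * (1 + norm w)" using \<delta> by simp
    also have "\<dots> = r" unfolding \<delta>_def by (simp add: add_pos_nonneg less_imp_neq[THEN not_sym])
    finally show ?thesis using t[of j] by (simp add: dist_norm)
  qed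
  define y where "y j = \<psi> (u + t j *\<^sub>R w)" for j
  have e: "norm (inverse (t j) *\<^sub>R (y j - \<psi> u) - D\<psi> u w) \<le> K * (norm w)\<^sup>2 * t j" for j
  proof -
    have "norm (y j - \<psi> u - t j *\<^sub>R D\<psi> u w) \<le> K * (t j * norm w)\<^sup>2"
      using D(3)[OF tw[of j]] t[of j] by (simp add: y_def linear_scale[OF D(1)])
    then have "inverse (t j) * norm (y j - \<psi> u - t j *\<^sub>R D\<psi> u w) \<le> inverse (t j) * (K * (t j * norm w)\<^sup>2)"
      using t[of j] by (intro mult_left_mono) auto
    also have "\<dots> = K * (norm w)\<^sup>2 * t j" using t[of j] by (simp add: power2_eq_square field_simps)
    finally have "norm (inverse (t j) *\<^sub>R (y j - \<psi> u - t j *\<^sub>R D\<psi> u w)) \<le> K * (norm w)\<^sup>2 * t j"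
      using t[of j] by simp
    moreover have "inverse (t j) *\<^sub>R (y j - \<psi> u - t j *\<^sub>R D\<psi> u w) = inverse (t j) *\<^sub>R (y j - \<psi> u) - D\<psi> u w"
      using t[of j] by (simp add: scaleR_diff_right)
    ultimately show ?thesis by simp
  qed
  have "(\<lambda>j. inverse (t j) *\<^sub>R (y j - \<psi> u) - D\<psi> u w) \<longlonglongrightarrow> 0"
  proof (rule Lim_null_comparison[OF always_eventually[OF allI[OF e]]])
    show "(\<lambda>j. K * (norm w)\<^sup>2 * t j) \<longlonglongrightarrow> 0" using t0 by (rule tendsto_mult_right_zero)
  qed
  then have lim: "(\<lambda>j. inverse (t j) *\<^sub>R (y j - \<psi> u)) \<longlonglongrightarrow> D\<psi> u w"
    by (simp add: LIM_zero_iff)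
  have "y \<longlonglongrightarrow> \<psi> u"
  proof -
    have "(\<lambda>j. t j *\<^sub>R (inverse (t j) *\<^sub>R (y j - \<psi> u))) \<longlonglongrightarrow> 0 *\<^sub>R D\<psi> u w"
      by (intro tendsto_scaleR t0 lim)
    moreover have "t j *\<^sub>R (inverse (t j) *\<^sub>R (y j - \<psi> u)) = y j - \<psi> u" for j using t[of j] by simp
    ultimately show ?thesis by (simp add: LIM_zero_iff)
  qed
  moreover have "y j \<in> S" for j
    unfolding y_def using tw[of j] r(2)
    by (intro \<psi>_in_S subspace_add[OF subspace_L] subspace_scale[OF subspace_L] assms) auto
  moreover have "inverse (t j) > 0" for j using t[of j] by simp
  ultimately show ?thesis using lim unfolding tangent_cone_def mem_Collect_eq
    by (intro exI[of _ y] exI[of _ "\<lambda>j. inverse (t j)"] conjI allI)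
qed

text \<open>The point \<open>\<psi> (\<phi> x + D\<phi> x \<xi>)\<close> lies in \<open>S\<close>, because \<open>D\<phi> x \<xi>\<close> lies in \<open>L\<close>, and the expansion of \<open>\<psi>\<close> at
  \<open>\<phi> x\<close> begins with \<open>x + \<xi>\<close>.\<close>

lemma tangent_step_near_submanifold:
  assumes "p \<in> S" and "p \<in> U"
  shows "\<exists>r>0. \<exists>K. \<forall>x\<in>S \<inter> ball p r. \<forall>\<xi>\<in>tangent_cone S x. norm \<xi> < r \<longrightarrow>
      (\<exists>y\<in>S. norm (y - (x + \<xi>)) \<le> K * (norm \<xi>)\<^sup>2)"
proof -
  obtain r1 K1 where r1: "r1 > 0" "ball (\<phi> p) r1 \<subseteq> V"
    and q1: "quadratic_expansion \<psi> D\<psi> (ball (\<phi> p) r1) K1"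
    using \<psi>_expansion[OF \<phi>_in_V[OF assms(2)]] by blast
  obtain r2 K2' where r2: "r2 > 0" "ball p r2 \<subseteq> U"
    and q2': "quadratic_expansion \<phi> D\<phi> (ball p r2) K2'"
    using \<phi>_expansion[OF assms(2)] by blast
  define K2 where "K2 = max 1 K2'"
  have q2: "quadratic_expansion \<phi> D\<phi> (ball p r2) K2"
    by (rule quadratic_expansion_mono[OF q2']) (auto simp: K2_def)
  have K2: "K2 \<ge> 1" by (simp add: K2_def)
  have K1: "K1 \<ge> 0"
  proof -
    obtain b :: "real ^ 'n" where "norm b = 1" using vector_choose_size[of 1] by auto
    then show ?thesis
      using quadratic_expansionD(2)[OF q1, of "\<phi> p" b] r1 norm_ge_zero[of "D\<psi> (\<phi> p) b"] by (simp del: norm_ge_zero)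
  qed
  have "isCont \<phi> p"
    using homeo open_U assms(2) by (simp add: homeomorphism_def continuous_on_eq_continuous_at)
  then obtain r3 where r3: "r3 > 0" "\<And>x. dist x p < r3 \<Longrightarrow> dist (\<phi> x) (\<phi> p) < r1 / 2"
    unfolding continuous_at_eps_delta using r1(1) half_gt_zero by blast
  define r where "r = min (min r2 r3) (r1 / (2 * K2))"
  have r: "r > 0" using r1 r2 r3 K2 by (simp add: r_def)
  have "\<exists>y\<in>S. norm (y - (x + \<xi>)) \<le> K1 * K2\<^sup>2 * (norm \<xi>)\<^sup>2"
    if xS: "x \<in> S" and x: "x \<in> ball p r" and \<xi>: "\<xi> \<in> tangent_cone S x" "norm \<xi> < r" for x \<xi>
  proof -
    have xr2: "x \<in> ball p r2" and xU: "x \<in> U" using x r2 by (auto simp: r_def)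
    have n: "norm (D\<phi> x \<xi>) \<le> K2 * norm \<xi>" using quadratic_expansionD(2)[OF q2 xr2] .
    have "K2 * norm \<xi> < K2 * (r1 / (2 * K2))"
      using K2 \<xi>(2) by (intro mult_strict_left_mono) (auto simp: r_def)
    then have n2: "norm (D\<phi> x \<xi>) < r1 / 2" using n K2 by simp
    have \<phi>x: "dist (\<phi> x) (\<phi> p) < r1 / 2" using r3(2)[of x] x by (simp add: r_def dist_commute)
    have b1: "\<phi> x \<in> ball (\<phi> p) r1" using \<phi>x r1 by (simp add: dist_commute)
    have b2: "\<phi> x + D\<phi> x \<xi> \<in> ball (\<phi> p) r1"
      using norm_triangle_ineq[of "\<phi> x - \<phi> p" "D\<phi> x \<xi>"] \<phi>x n2
      by (simp add: dist_norm norm_minus_commute algebra_simps)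
    have "\<phi> x + D\<phi> x \<xi> \<in> L"
      by (intro subspace_add subspace_L \<phi>_in_L D\<phi>_tangent xS xU \<xi>)
    then have "\<psi> (\<phi> x + D\<phi> x \<xi>) \<in> S" using b2 r1(2) \<psi>_in_S by blast
    moreover have "norm (\<psi> (\<phi> x + D\<phi> x \<xi>) - (x + \<xi>)) \<le> K1 * (norm (D\<phi> x \<xi>))\<^sup>2"
      using quadratic_expansionD(3)[OF q1 b1 b2] by (simp add: \<psi>_\<phi>[OF xU] D\<psi>_D\<phi>[OF xU] algebra_simps)
    moreover have "K1 * (norm (D\<phi> x \<xi>))\<^sup>2 \<le> K1 * (K2 * norm \<xi>)\<^sup>2"
      using n K1 by (intro mult_left_mono power_mono) auto
    ultimately show ?thesis by (intro bexI[of _ "\<psi> (\<phi> x + D\<phi> x \<xi>)"]) (auto simp: power_mult_distrib mult.assoc)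
  qed
  then show ?thesis using r by (intro exI[of _ r] conjI exI[of _ "K1 * K2\<^sup>2"]) auto
qed

text \<open>The differential of \<open>\<psi>\<close> carries one fixed coordinate vector to tangent vectors at all nearby points,
  and it depends continuously on the base point.\<close>

lemma tangent_transport:
  assumes "p \<in> S" and "p \<in> U" and "\<xi> \<in> tangent_cone S p"
    and "\<forall>\<^sub>F n in sequentially. x n \<in> S" and "x \<longlonglongrightarrow> p"
  shows "\<exists>\<zeta>. (\<forall>\<^sub>F n in sequentially. \<zeta> n \<in> tangent_cone S (x n)) \<and> \<zeta> \<longlonglongrightarrow> \<xi>"
proof (intro exI conjI)
  define \<zeta> where "\<zeta> n = D\<psi> (\<phi> (x n)) (D\<phi> p \<xi>)" for n
  obtain r K where r: "r > 0" "ball (\<phi> p) r \<subseteq> V"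
    and q: "quadratic_expansion \<psi> D\<psi> (ball (\<phi> p) r) K"
    using \<psi>_expansion[OF \<phi>_in_V[OF assms(2)]] by blast
  have xU: "\<forall>\<^sub>F n in sequentially. x n \<in> U" using topological_tendstoD[OF assms(5) open_U assms(2)] .
  from eventually_conj[OF this assms(4)]
  show "\<forall>\<^sub>F n in sequentially. \<zeta> n \<in> tangent_cone S (x n)"
  proof (rule eventually_mono)
    fix n assume "x n \<in> U \<and> x n \<in> S"
    then show "\<zeta> n \<in> tangent_cone S (x n)"
      using D\<psi>_tangent[of "\<phi> (x n)" "D\<phi> p \<xi>"] \<phi>_in_V \<phi>_in_L D\<phi>_tangent[OF assms(1-3)] \<psi>_\<phi>
      by (simp add: \<zeta>_def)
  qed
  have "isCont \<phi> p"
    using homeo open_U assms(2) by (simp add: homeomorphism_def continuous_on_eq_continuous_at)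
  then have \<phi>x: "(\<lambda>n. \<phi> (x n)) \<longlonglongrightarrow> \<phi> p" using assms(5) by (rule isCont_tendsto_compose)
  have "(\<lambda>n. \<zeta> n - \<xi>) \<longlonglongrightarrow> 0"
  proof (rule Lim_null_comparison)
    have "\<forall>\<^sub>F n in sequentially. \<phi> (x n) \<in> ball (\<phi> p) (r / 3)"
      using topological_tendstoD[OF \<phi>x, of "ball (\<phi> p) (r/3)"] r by simp
    then show "\<forall>\<^sub>F n in sequentially. norm (\<zeta> n - \<xi>) \<le> 6 * K * norm (\<phi> (x n) - \<phi> p) * norm (D\<phi> p \<xi>)"
    proof (rule eventually_mono)
      fix n assume "\<phi> (x n) \<in> ball (\<phi> p) (r / 3)"
      then show "norm (\<zeta> n - \<xi>) \<le> 6 * K * norm (\<phi> (x n) - \<phi> p) * norm (D\<phi> p \<xi>)"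
        using quadratic_expansion_derivative_Lipschitz[OF q, of "\<phi> p" "\<phi> (x n)" "D\<phi> p \<xi>"] r
        by (simp add: \<zeta>_def D\<psi>_D\<phi>[OF assms(2)])
    qed
    have "(\<lambda>n. 6 * K * norm (\<phi> (x n) - \<phi> p) * norm (D\<phi> p \<xi>)) \<longlonglongrightarrow> 6 * K * norm (\<phi> p - \<phi> p) * norm (D\<phi> p \<xi>)"
      by (intro tendsto_intros \<phi>x)
    then show "(\<lambda>n. 6 * K * norm (\<phi> (x n) - \<phi> p) * norm (D\<phi> p \<xi>)) \<longlonglongrightarrow> 0" by simp
  qed
  then show "\<zeta> \<longlonglongrightarrow> \<xi>" by (simp add: LIM_zero_iff)
qed

end

section \<open>The projected antigradient and the metric projection\<close>

lemma tangent_cone_0: "x \<in> M \<Longrightarrow> 0 \<in> tangent_cone M x"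
  unfolding tangent_cone_def
  by (simp, rule exI[of _ "\<lambda>_. x"], simp, rule exI[of _ "\<lambda>_. 1"], simp)

lemma tangent_cone_scaleR:
  assumes "\<xi> \<in> tangent_cone M x" and "t > 0"
  shows "t *\<^sub>R \<xi> \<in> tangent_cone M x"
proof -
  obtain y a where y: "\<And>j. y j \<in> M" "\<And>j. a j > 0" "y \<longlonglongrightarrow> x" "(\<lambda>j. a j *\<^sub>R (y j - x)) \<longlonglongrightarrow> \<xi>"
    using assms(1) unfolding tangent_cone_def by blast
  have "(\<lambda>j. (t * a j) *\<^sub>R (y j - x)) \<longlonglongrightarrow> t *\<^sub>R \<xi>"
    using tendsto_scaleR[OF tendsto_const y(4), of t] by simp
  moreover have "t * a j > 0" for j using y(2) assms(2) by simp
  ultimately show ?thesis unfolding tangent_cone_def mem_Collect_eq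
    by (intro exI[of _ y] exI[of _ "\<lambda>j. t * a j"] conjI allI y)
qed

lemma infdist_le_norm_grad:
  assumes "x \<in> M"
  shows "infdist (- grad f x) (tangent_cone M x) \<le> norm (grad f x)"
  using infdist_le[OF tangent_cone_0[OF assms], of "- grad f x"] by simp

lemma proj_antigrad_norm_nonneg:
  assumes "x \<in> M" shows "0 \<le> proj_antigrad_norm M f x"
  using infdist_le_norm_grad[OF assms, of f]
  by (simp add: proj_antigrad_norm_def power_mono infdist_nonneg)

lemma proj_antigrad_norm_le_norm_grad: "proj_antigrad_norm M f x \<le> norm (grad f x)"
  unfolding proj_antigrad_norm_def by (rule real_le_lsqrt) auto

text \<open>The tangent cone contains the ray through \<open>\<xi>\<close>, so the distance of \<open>- grad f x\<close> to the cone is at most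
  its distance to the orthogonal projection onto that ray.\<close>

lemma neg_slope_le_proj_antigrad_norm:
  assumes "x \<in> M" and "\<xi> \<in> tangent_cone M x"
  shows "- (grad f x \<bullet> \<xi>) \<le> proj_antigrad_norm M f x * norm \<xi>"
proof (cases "grad f x \<bullet> \<xi> < 0")
  case False
  then show ?thesis
    using proj_antigrad_norm_nonneg[OF assms(1), of f] by (smt (verit) mult_nonneg_nonneg norm_ge_zero)
next
  case True
  define v where "v = - grad f x"
  define t where "t = (v \<bullet> \<xi>) / (norm \<xi>)\<^sup>2"
  have v\<xi>: "v \<bullet> \<xi> > 0" using True by (simp add: v_def)
  then have n: "norm \<xi> > 0" by auto
  have t: "t > 0" using v\<xi> n by (simp add: t_def)
  have "infdist v (tangent_cone M x) \<le> dist v (t *\<^sub>R \<xi>)"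
    by (rule infdist_le[OF tangent_cone_scaleR[OF assms(2) t]])
  then have "(infdist v (tangent_cone M x))\<^sup>2 \<le> (norm (v - t *\<^sub>R \<xi>))\<^sup>2"
    by (simp add: dist_norm power_mono infdist_nonneg)
  also have "\<dots> = (norm v)\<^sup>2 - 2 * t * (v \<bullet> \<xi>) + t\<^sup>2 * (norm \<xi>)\<^sup>2"
    unfolding power2_norm_eq_inner
    by (simp add: inner_diff_left inner_diff_right inner_commute power2_eq_square algebra_simps)
  also have "\<dots> = (norm v)\<^sup>2 - ((v \<bullet> \<xi>) / norm \<xi>)\<^sup>2"
    using n by (simp add: t_def power2_eq_square field_simps)
  finally have "((v \<bullet> \<xi>) / norm \<xi>)\<^sup>2 \<le> (norm v)\<^sup>2 - (infdist v (tangent_cone M x))\<^sup>2" by simp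
  then have "(v \<bullet> \<xi>) / norm \<xi> \<le> sqrt ((norm v)\<^sup>2 - (infdist v (tangent_cone M x))\<^sup>2)"
    by (rule real_le_rsqrt)
  then have "(v \<bullet> \<xi>) / norm \<xi> \<le> proj_antigrad_norm M f x"
    by (simp add: proj_antigrad_norm_def v_def)
  then show ?thesis by (simp only: pos_divide_le_eq[OF n] v_def inner_minus_left)
qed

text \<open>If no tangent vector is a descent direction, then \<open>0\<close> is a closest point of the tangent cone to
  \<open>- grad f x\<close>, and the projected antigradient norm vanishes.\<close>

lemma descent_direction_exists:
  assumes "x \<in> M" and "proj_antigrad_norm M f x \<noteq> 0"
  shows "\<exists>\<xi>\<in>tangent_cone M x. grad f x \<bullet> \<xi> < 0"
proof (rule ccontr)
  assume contra: "\<not> ?thesis"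
  define v where "v = - grad f x"
  have "norm v \<le> dist v \<xi>" if "\<xi> \<in> tangent_cone M x" for \<xi>
  proof -
    have "v \<bullet> \<xi> \<le> 0" using contra that by (auto simp: v_def not_less)
    then have "(norm v)\<^sup>2 \<le> (norm (v - \<xi>))\<^sup>2"
      by (simp add: power2_norm_eq_inner inner_diff_left inner_diff_right inner_commute)
        (smt (verit) inner_ge_zero)
    then show ?thesis by (simp add: dist_norm)
  qed
  then have "norm v \<le> infdist v (tangent_cone M x)"
    using tangent_cone_0[OF assms(1)] unfolding infdist_def by (auto intro!: cINF_greatest)
  then have "infdist v (tangent_cone M x) = norm v"
    using infdist_le_norm_grad[OF assms(1), of f] by (simp add: v_def)
  then show False using assms(2) by (simp add: proj_antigrad_norm_def v_def)
qed

lemma is_norm_equivalent: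
  fixes N :: "'a::euclidean_space \<Rightarrow> real"
  assumes "is_norm N"
  shows "\<exists>C>0. \<forall>x. N x \<le> C * norm x \<and> norm x \<le> C * N x"
proof -
  have N0: "N x = 0 \<longleftrightarrow> x = 0" and Ns: "N (a *\<^sub>R x) = \<bar>a\<bar> * N x" and Nt: "N (x + y) \<le> N x + N y" for x y a
    using assms by (auto simp: is_norm_def)
  have Nm: "N (- x) = N x" for x using Ns[of "-1" x] by simp
  have Npos: "N x \<ge> 0" for x using Nt[of x "-x"] Nm[of x] N0[of 0] by simp
  define A where "A = (\<Sum>b\<in>Basis. N b :: real)"
  have sub: "N (\<Sum>b\<in>B. g b) \<le> (\<Sum>b\<in>B. N (g b))" if "finite B" for B and g :: "'a \<Rightarrow> 'a"
    using that by (induction B) (auto simp: N0[THEN iffD2] intro: order_trans[OF Nt])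
  have up: "N x \<le> A * norm x" for x
  proof -
    have "N x = N (\<Sum>b\<in>Basis. (x \<bullet> b) *\<^sub>R b)" by (simp add: euclidean_representation)
    also have "\<dots> \<le> (\<Sum>b\<in>Basis. N ((x \<bullet> b) *\<^sub>R b))" by (rule sub) simp
    also have "\<dots> \<le> (\<Sum>b\<in>Basis. N b * norm x)"
    proof (rule sum_mono)
      fix b :: 'a assume "b \<in> Basis"
      then show "N ((x \<bullet> b) *\<^sub>R b) \<le> N b * norm x"
        unfolding Ns using Npos[of b] Basis_le_norm[of b x] by (simp add: mult.commute mult_left_mono)
    qed
    finally show ?thesis by (simp add: A_def sum_distrib_right)
  qed
  have "continuous_on (sphere 0 1) N"
  proof (rule continuous_on_subset[OF lipschitz_on_continuous_on[of "A"]])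
    show "A-lipschitz_on UNIV N"
    proof (rule lipschitz_onI)
      fix x y
      have "N x \<le> N y + A * norm (x - y)" "N y \<le> N x + A * norm (x - y)"
        using Nt[of y "x - y"] Nt[of x "y - x"] up[of "x - y"] up[of "y - x"] by (simp_all add: norm_minus_commute)
      then show "dist (N x) (N y) \<le> A * dist x y" by (simp add: dist_norm)
    qed (simp add: A_def sum_nonneg Npos)
  qed simp
  moreover have "sphere (0::'a) 1 \<noteq> {}" by simp
  ultimately obtain z where z: "z \<in> sphere 0 1" "\<And>y. y \<in> sphere 0 1 \<Longrightarrow> N z \<le> N y"
    using continuous_attains_inf[OF compact_sphere] by metis
  have Nz: "N z > 0" using N0[of z] Npos[of z] z(1) by (auto simp: less_le)
  have down: "norm x \<le> (1 / N z) * N x" for x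
  proof (cases "x = 0")
    case False
    have "N z \<le> N ((1 / norm x) *\<^sub>R x)" using False by (intro z(2)) simp
    then show ?thesis unfolding Ns using False Nz by (simp add: field_simps)
  qed (simp add: N0[THEN iffD2])
  define C where "C = max A (1 / N z)"
  have "N x \<le> C * norm x" "norm x \<le> C * N x" for x
    using up[of x] down[of x] Npos[of x] unfolding C_def
    by (meson max.cobounded1 max.cobounded2 mult_right_mono norm_ge_zero order_trans)+
  moreover have "C > 0" using Nz by (simp add: C_def less_max_iff_disj)
  ultimately show ?thesis by blast
qed

text \<open>Minimality in the norm \<open>N\<close> costs only the constants of the equivalence with the Euclidean norm, which
  is why the choice of the norm is immaterial.\<close>

lemma metric_projection_quasi_optimal:
  assumes "is_norm N" and "metric_projection N M R"
  shows "\<exists>C>0. \<forall>x\<in>M. \<forall>\<xi>\<in>tangent_cone M x. \<forall>y\<in>M.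
      norm (R x \<xi> - (x + \<xi>)) \<le> C * norm (y - (x + \<xi>))"
proof -
  obtain C where C: "C > 0" "\<And>x. N x \<le> C * norm x" "\<And>x. norm x \<le> C * N x"
    using is_norm_equivalent[OF assms(1)] by blast
  have "norm (R x \<xi> - (x + \<xi>)) \<le> (C * C) * norm (y - (x + \<xi>))"
    if "x \<in> M" "\<xi> \<in> tangent_cone M x" "y \<in> M" for x \<xi> y
  proof -
    have "N (R x \<xi> - (x + \<xi>)) \<le> N (y - (x + \<xi>))"
      using assms(2) that unfolding metric_projection_def is_arg_min_linorder by blast
    then have "C * N (R x \<xi> - (x + \<xi>)) \<le> C * (C * norm (y - (x + \<xi>)))"
      using C(1) C(2)[of "y - (x + \<xi>)"] by (intro mult_left_mono) auto
    then show ?thesis using C(3)[of "R x \<xi> - (x + \<xi>)"] by simp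
  qed
  then show ?thesis using C(1) by (intro exI[of _ "C * C"]) auto
qed

lemma slice_chart_exists:
  fixes S :: "(real ^ 'n::finite) set"
  assumes "smooth_embedded_submanifold S" and "p \<in> S"
  shows "\<exists>U V \<phi> \<psi> L. slice_chart S U V \<phi> \<psi> L \<and> p \<in> U"
  using assms unfolding smooth_embedded_submanifold_def slice_chart_def by blast

lemma metric_projection_second_order:
  fixes M :: "(real ^ 'n::finite) set"
  assumes "is_norm N" and "metric_projection N M R"
    and "open W" and "p \<in> M" and "p \<in> W" and "smooth_embedded_submanifold (M \<inter> W)"
  shows "\<exists>r>0. \<exists>K. \<forall>x\<in>M \<inter> ball p r. \<forall>\<xi>\<in>tangent_cone M x. norm \<xi> < r \<longrightarrow>
      norm (R x \<xi> - (x + \<xi>)) \<le> K * (norm \<xi>)\<^sup>2"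
proof -
  obtain C where C: "C > 0" "\<And>x \<xi> y. x \<in> M \<Longrightarrow> \<xi> \<in> tangent_cone M x \<Longrightarrow> y \<in> M \<Longrightarrow>
      norm (R x \<xi> - (x + \<xi>)) \<le> C * norm (y - (x + \<xi>))"
    using metric_projection_quasi_optimal[OF assms(1,2)] by blast
  obtain U V \<phi> \<psi> L where "slice_chart (M \<inter> W) U V \<phi> \<psi> L" "p \<in> U"
    using slice_chart_exists[OF assms(6)] assms(4,5) by blast
  from slice_chart.tangent_step_near_submanifold[OF this(1) _ this(2)]
  obtain r K where r: "r > 0" and K: "\<And>x \<xi>. x \<in> M \<inter> W \<Longrightarrow> x \<in> ball p r \<Longrightarrow>
      \<xi> \<in> tangent_cone (M \<inter> W) x \<Longrightarrow> norm \<xi> < r \<Longrightarrow>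
      \<exists>y\<in>M \<inter> W. norm (y - (x + \<xi>)) \<le> K * (norm \<xi>)\<^sup>2"
    using assms(4,5) by blast
  obtain r' where r': "r' > 0" "ball p r' \<subseteq> W" using assms(3,5) open_contains_ball by blast
  have "norm (R x \<xi> - (x + \<xi>)) \<le> (C * K) * (norm \<xi>)\<^sup>2"
    if "x \<in> M" "x \<in> ball p (min r r')" "\<xi> \<in> tangent_cone M x" "norm \<xi> < min r r'" for x \<xi>
  proof -
    have xW: "x \<in> W" and xr: "x \<in> ball p r" and \<xi>r: "norm \<xi> < r" using that(2,4) r'(2) by auto
    have "\<xi> \<in> tangent_cone (M \<inter> W) x" using that(3) tangent_cone_Int_open[OF assms(3) xW] by blast
    from K[OF IntI[OF that(1) xW] xr this \<xi>r]
    obtain y where "y \<in> M" "norm (y - (x + \<xi>)) \<le> K * (norm \<xi>)\<^sup>2" by blast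
    then have "C * norm (y - (x + \<xi>)) \<le> C * (K * (norm \<xi>)\<^sup>2)"
      using C(1) by (intro mult_left_mono) auto
    then show ?thesis using C(2)[OF that(1,3) \<open>y \<in> M\<close>] by simp
  qed
  then show ?thesis using r r'(1) by (intro exI[of _ "min r r'"] conjI exI[of _ "C * K"]) auto
qed

text \<open>This is an instance of lower semicontinuity of the projected antigradient norm along \<open>M\<close>: a descent
  direction at the limit, transported to the points \<open>x n\<close>, would keep their values away from zero.\<close>

lemma proj_antigrad_norm_limit_zero:
  fixes M :: "(real ^ 'n::finite) set"
  assumes "open W" and "p \<in> M" and "p \<in> W" and "smooth_embedded_submanifold (M \<inter> W)"
    and "\<And>n. x n \<in> M" and x: "x \<longlonglongrightarrow> p" and grad: "(\<lambda>n. grad f (x n)) \<longlonglongrightarrow> grad f p"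
    and g0: "(\<lambda>n. proj_antigrad_norm M f (x n)) \<longlonglongrightarrow> 0"
  shows "proj_antigrad_norm M f p = 0"
proof (rule ccontr)
  assume "proj_antigrad_norm M f p \<noteq> 0"
  then obtain \<xi> where \<xi>: "\<xi> \<in> tangent_cone M p" "grad f p \<bullet> \<xi> < 0"
    using descent_direction_exists[OF assms(2)] by blast
  obtain U V \<phi> \<psi> L where chart: "slice_chart (M \<inter> W) U V \<phi> \<psi> L" "p \<in> U"
    using slice_chart_exists[OF assms(4)] assms(2,3) by blast
  have xW: "\<forall>\<^sub>F n in sequentially. x n \<in> W" by (rule topological_tendstoD[OF x assms(1,3)])
  then have "\<forall>\<^sub>F n in sequentially. x n \<in> M \<inter> W" using assms(5) by simp
  then obtain \<zeta> where \<zeta>: "\<forall>\<^sub>F n in sequentially. \<zeta> n \<in> tangent_cone (M \<inter> W) (x n)" "\<zeta> \<longlonglongrightarrow> \<xi>"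
    using slice_chart.tangent_transport[OF chart(1) _ chart(2) _ _ x, of \<xi>] assms(2,3) \<xi>(1)
      tangent_cone_Int_open[OF assms(1,3), of M] by blast
  have "- (grad f p \<bullet> \<xi>) \<le> 0 * norm \<xi>"
  proof (rule tendsto_le[OF sequentially_bot])
    show "(\<lambda>n. - (grad f (x n) \<bullet> \<zeta> n)) \<longlonglongrightarrow> - (grad f p \<bullet> \<xi>)" by (intro tendsto_intros grad \<zeta>)
    show "(\<lambda>n. proj_antigrad_norm M f (x n) * norm (\<zeta> n)) \<longlonglongrightarrow> 0 * norm \<xi>"
      by (intro tendsto_intros g0 \<zeta>)
    show "\<forall>\<^sub>F n in sequentially. - (grad f (x n) \<bullet> \<zeta> n) \<le> proj_antigrad_norm M f (x n) * norm (\<zeta> n)"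
      using eventually_conj[OF xW \<zeta>(1)]
    proof (rule eventually_mono)
      fix n assume "x n \<in> W \<and> \<zeta> n \<in> tangent_cone (M \<inter> W) (x n)"
      then show "- (grad f (x n) \<bullet> \<zeta> n) \<le> proj_antigrad_norm M f (x n) * norm (\<zeta> n)"
        using neg_slope_le_proj_antigrad_norm[OF assms(5)] tangent_cone_Int_open[OF assms(1), of "x n" M] by blast
    qed
  qed
  then show False using \<xi>(2) by simp
qed

section \<open>The Armijo line search\<close>

text \<open>The Armijo condition along a curve only involves the real function \<open>h\<close>, the increment of the objective.
  Because the slope at zero satisfies \<open>s < c * s\<close>, the strict inequality holds on an initial interval;
  because \<open>h\<close> is bounded below, it fails eventually. So the set of equality points is nonempty, closed and
  bounded away from zero, and its least element \<open>\<alpha>\<^sub>0\<close> exists. Before \<open>\<alpha>\<^sub>0\<close> the condition holds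
  strictly, so backtracking terminates, and the last rejected trial step is at least \<open>\<alpha>\<^sub>0\<close>.\<close>

lemma armijo_search:
  fixes h :: "real \<Rightarrow> real"
  assumes cont: "continuous_on {0..} h" 
    and slope: "((\<lambda>\<alpha>. h \<alpha> / \<alpha>) \<longlongrightarrow> s) (at_right 0)" and s: "s < 0"
    and below: "\<And>\<alpha>. \<alpha> \<ge> 0 \<Longrightarrow> B \<le> h \<alpha>"
    and c: "0 < c" "c < 1" and \<beta>: "0 < \<beta>" "\<beta> < 1" and \<gamma>: "\<gamma> > 0"
  defines "\<alpha>\<^sub>0 \<equiv> LEAST \<alpha>. \<alpha> > 0 \<and> h \<alpha> = c * \<alpha> * s"
  assumes b: "b \<ge> min \<gamma> \<alpha>\<^sub>0"
  defines "\<alpha>\<^sub>1 \<equiv> GREATEST \<alpha>. \<exists>m::nat. \<alpha> = \<beta> ^ m * b \<and> h \<alpha> \<le> c * \<alpha> * s"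
  shows "\<alpha>\<^sub>0 > 0" and "h \<alpha>\<^sub>0 = c * \<alpha>\<^sub>0 * s" and "h \<alpha>\<^sub>1 \<le> c * \<alpha>\<^sub>1 * s" and "\<beta> * min \<gamma> \<alpha>\<^sub>0 \<le> \<alpha>\<^sub>1"
proof -
  define k where "k \<alpha> = h \<alpha> - c * \<alpha> * s" for \<alpha>
  have kcont: "continuous_on {a..a'} k" if "a \<ge> 0" for a a'
    unfolding k_def using that by (intro continuous_intros continuous_on_subset[OF cont]) auto
  have "s < c * s" using s c by simp
  then have "\<forall>\<^sub>F \<alpha> in at_right 0. h \<alpha> / \<alpha> < c * s" by (rule order_tendstoD(2)[OF slope])
  then obtain d where d: "d > 0" "\<And>\<alpha>. 0 < \<alpha> \<Longrightarrow> \<alpha> < d \<Longrightarrow> h \<alpha> / \<alpha> < c * s"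
    by (auto simp: eventually_at_right_field)
  have near: "k \<alpha> < 0" if "0 < \<alpha>" "\<alpha> < d" for \<alpha>
    using d(2)[OF that] that by (simp add: k_def divide_less_eq ac_simps)
  have root: "\<exists>z. d \<le> z \<and> z \<le> t \<and> k z = 0" if "0 < t" "k t \<ge> 0" for t
  proof -
    have "d \<le> t" using near[OF that(1)] that(2) by linarith
    then have "\<exists>z\<ge>d/2. z \<le> t \<and> k z = 0"
      using near[of "d/2"] d(1) that(2) by (intro IVT' kcont) auto
    then obtain z where z: "z \<ge> d/2" "z \<le> t" "k z = 0" by blast
    then have "d \<le> z" using near[of z] d(1) by force
    with z show ?thesis by blast
  qed
  define E where "E = {d..} \<inter> k -` {0}"
  have "closed E"
    unfolding E_def k_def using d(1)
    by (intro continuous_closed_preimage continuous_intros continuous_on_subset[OF cont]) auto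
  moreover have "E \<noteq> {}"
  proof -
    define t where "t = max d (\<bar>B\<bar> / (c * (- s)))"
    have cs: "c * (- s) > 0" using c s by (simp add: mult_pos_neg)
    have t: "t > 0" using d(1) by (simp add: t_def)
    have "\<bar>B\<bar> / (c * (- s)) \<le> t" by (simp add: t_def)
    then have "\<bar>B\<bar> \<le> t * (c * (- s))" using cs by (simp only: pos_divide_le_eq)
    then have "k t \<ge> 0" using below[of t] t by (simp add: k_def ac_simps)
    from root[OF t this] show ?thesis by (auto simp: E_def)
  qed
  moreover have bddE: "bdd_below E" by (rule bdd_belowI[of _ d]) (simp add: E_def)
  ultimately have I: "Inf E \<in> E" by (intro closed_contains_Inf)
  have "\<alpha>\<^sub>0 = Inf E"
    unfolding \<alpha>\<^sub>0_def
  proof (rule Least_equality)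
    show "0 < Inf E \<and> h (Inf E) = c * Inf E * s" using I d(1) by (simp add: E_def k_def)
    fix y assume "0 < y \<and> h y = c * y * s"
    then have "y \<in> E" using near[of y] by (force simp: E_def k_def)
    then show "Inf E \<le> y" using bddE by (rule cInf_lower)
  qed
  then have \<alpha>0: "\<alpha>\<^sub>0 \<in> E" using I by simp
  then show pos: "\<alpha>\<^sub>0 > 0" and "h \<alpha>\<^sub>0 = c * \<alpha>\<^sub>0 * s" using d(1) by (simp_all add: E_def k_def)
  have before: "k t < 0" if "0 < t" "t < \<alpha>\<^sub>0" for t
  proof (rule ccontr)
    assume "\<not> k t < 0"
    then obtain z where "d \<le> z" "z \<le> t" "k z = 0" using root[of t] \<open>0 < t\<close> by force
    then have "Inf E \<le> t" using cInf_lower[OF _ bddE, of z] by (simp add: E_def)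
    then show False using that \<open>\<alpha>\<^sub>0 = Inf E\<close> by simp
  qed
  have bpos: "b > 0" using b \<gamma> pos by simp
  have "(\<lambda>m. \<beta> ^ m * b) \<longlonglongrightarrow> 0 * b"
    using \<beta> by (intro tendsto_mult LIMSEQ_realpow_zero tendsto_const) auto
  then have "\<forall>\<^sub>F m in sequentially. \<beta> ^ m * b < \<alpha>\<^sub>0" using pos by (intro order_tendstoD(2)) auto
  then obtain m' where "\<beta> ^ m' * b < \<alpha>\<^sub>0" by (auto simp: eventually_sequentially)
  then have ex: "k (\<beta> ^ m' * b) \<le> 0" using before[of "\<beta> ^ m' * b"] \<beta> bpos by simp
  define m where "m = (LEAST m. k (\<beta> ^ m * b) \<le> 0)"
  have m: "k (\<beta> ^ m * b) \<le> 0" unfolding m_def using ex by (rule LeastI)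
  have m_least: "m \<le> j" if "k (\<beta> ^ j * b) \<le> 0" for j unfolding m_def using that by (rule Least_le)
  have \<alpha>1: "\<alpha>\<^sub>1 = \<beta> ^ m * b"
    unfolding \<alpha>\<^sub>1_def
  proof (rule Greatest_equality)
    show "\<exists>ma. \<beta> ^ m * b = \<beta> ^ ma * b \<and> h (\<beta> ^ m * b) \<le> c * (\<beta> ^ m * b) * s"
      using m by (intro exI[of _ m]) (simp add: k_def)
    fix y assume "\<exists>j. y = \<beta> ^ j * b \<and> h y \<le> c * y * s"
    then obtain j where j: "y = \<beta> ^ j * b" "k (\<beta> ^ j * b) \<le> 0" by (auto simp: k_def)
    show "y \<le> \<beta> ^ m * b"
      unfolding j(1) using m_least[OF j(2)] \<beta> bpos by (intro mult_right_mono power_decreasing) auto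
  qed
  show "h \<alpha>\<^sub>1 \<le> c * \<alpha>\<^sub>1 * s" using m by (simp add: \<alpha>1 k_def)
  have mn: "min \<gamma> \<alpha>\<^sub>0 > 0" using \<gamma> pos by simp
  show "\<beta> * min \<gamma> \<alpha>\<^sub>0 \<le> \<alpha>\<^sub>1"
  proof (cases m)
    case 0
    have "\<beta> * min \<gamma> \<alpha>\<^sub>0 \<le> min \<gamma> \<alpha>\<^sub>0" using \<beta> mn by (intro mult_left_le_one_le) auto
    also note b
    finally show ?thesis by (simp add: \<alpha>1 0)
  next
    case (Suc j)
    then have "\<not> k (\<beta> ^ j * b) \<le> 0" using m_least[of j] by auto
    then have "\<alpha>\<^sub>0 \<le> \<beta> ^ j * b" using before[of "\<beta> ^ j * b"] \<beta> bpos by (force simp: not_le)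
    then have "\<beta> * min \<gamma> \<alpha>\<^sub>0 \<le> \<beta> * (\<beta> ^ j * b)" using \<beta> by (intro mult_left_mono) auto
    then show ?thesis by (simp add: \<alpha>1 Suc mult.assoc)
  qed
qed

text \<open>These global properties of the objective and the retraction suffice for a well-defined step and its
  decrease; what holds only near the cluster point enters as an assumption of the bound on the step
  length. The assumption \<open>C \<ge> 1\<close> is a normalization of the linear bound that permits
  division by \<open>C\<close>.\<close>

locale armijo_line_search =
  fixes M :: "(real ^ 'n::finite) set" and f :: "real ^ 'n \<Rightarrow> real"
    and R :: "real ^ 'n \<Rightarrow> real ^ 'n \<Rightarrow> real ^ 'n" and \<omega> \<beta> c B C :: real
  assumes gderiv: "x \<in> M \<Longrightarrow> GDERIV f x :> grad f x"
    and below: "x \<in> M \<Longrightarrow> B \<le> f x"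
    and retraction: "tangent_cone_retraction M R"
    and linear_bound: "x \<in> M \<Longrightarrow> \<xi> \<in> tangent_cone M x \<Longrightarrow> norm (R x \<xi> - x) \<le> C * norm \<xi>"
    and C: "C \<ge> 1" and \<omega>: "0 < \<omega>" and \<beta>: "0 < \<beta>" "\<beta> < 1" and c: "0 < c" "c < 1"
begin

abbreviation "T \<equiv> tangent_cone M"
abbreviation "g \<equiv> proj_antigrad_norm M f"

lemma R_in_M: "x \<in> M \<Longrightarrow> \<xi> \<in> T x \<Longrightarrow> R x \<xi> \<in> M"
  using retraction by (auto simp: tangent_cone_retraction_def)

lemma R_0: "x \<in> M \<Longrightarrow> R x 0 = x"
  using linear_bound[of x 0] tangent_cone_0[of x M] by simp

lemma T_scale: "x \<in> M \<Longrightarrow> \<xi> \<in> T x \<Longrightarrow> \<alpha> \<ge> 0 \<Longrightarrow> \<alpha> *\<^sub>R \<xi> \<in> T x"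
  by (cases "\<alpha> = 0") (auto simp: tangent_cone_0 intro: tangent_cone_scaleR)

lemma continuous_f: "continuous_on M f"
proof (rule continuous_at_imp_continuous_on, rule ballI)
  fix x assume "x \<in> M"
  then show "isCont f x"
    using has_derivative_continuous[OF gderiv[unfolded gderiv_def]] by blast
qed

lemma retraction_slope:
  assumes x: "x \<in> M" and \<xi>: "\<xi> \<in> T x"
  shows "((\<lambda>\<alpha>. (f (R x (\<alpha> *\<^sub>R \<xi>)) - f x) / \<alpha>) \<longlongrightarrow> grad f x \<bullet> \<xi>) (at_right 0)"
proof -
  define \<gamma> where "\<gamma> \<alpha> = R x (\<alpha> *\<^sub>R \<xi>)" for \<alpha>
  have \<gamma>0: "\<gamma> 0 = x" by (simp add: \<gamma>_def R_0[OF x])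
  have lim: "((\<lambda>\<alpha>. (R x (\<alpha> *\<^sub>R \<xi>) - (x + \<alpha> *\<^sub>R \<xi>)) /\<^sub>R \<alpha>) \<longlongrightarrow> 0) (at_right 0)"
    using retraction x \<xi> unfolding tangent_cone_retraction_def by blast
  have "(\<gamma> has_derivative (\<lambda>\<alpha>. \<alpha> *\<^sub>R \<xi>)) (at 0 within {0<..})"
    unfolding has_derivative_iff_norm
  proof
    show "bounded_linear (\<lambda>\<alpha>. \<alpha> *\<^sub>R \<xi>)" by (rule bounded_linear_scaleR_left)
    have "((\<lambda>\<alpha>. norm ((R x (\<alpha> *\<^sub>R \<xi>) - (x + \<alpha> *\<^sub>R \<xi>)) /\<^sub>R \<alpha>)) \<longlongrightarrow> 0) (at_right 0)"
      using tendsto_norm[OF lim] by simp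
    then show "((\<lambda>y. norm (\<gamma> y - \<gamma> 0 - (y - 0) *\<^sub>R \<xi>) / norm (y - 0)) \<longlongrightarrow> 0) (at_right 0)"
      by (rule Lim_transform_eventually)
        (auto simp: eventually_at_filter \<gamma>0[unfolded \<gamma>_def] \<gamma>_def R_0[OF x] diff_diff_eq divide_inverse ac_simps)
  qed
  moreover have "(f has_derivative (\<lambda>h. h \<bullet> grad f x)) (at (\<gamma> 0))"
    using gderiv[OF x] by (simp add: gderiv_def \<gamma>0)
  ultimately have "((\<lambda>\<alpha>. f (\<gamma> \<alpha>)) has_derivative (\<lambda>\<alpha>. (\<alpha> *\<^sub>R \<xi>) \<bullet> grad f x)) (at_right 0)"
    by (rule has_derivative_compose)
  then have "((\<lambda>\<alpha>. f (\<gamma> \<alpha>)) has_field_derivative (grad f x \<bullet> \<xi>)) (at_right 0)"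
    unfolding has_field_derivative_def by (rule has_derivative_eq_rhs) (auto simp: inner_commute)
  then show ?thesis
    unfolding has_field_derivative_iff by (simp add: \<gamma>_def R_0[OF x])
qed

text \<open>The description is in terms of displacements: \<open>\<zeta>\<close> is the accepted tangent vector and \<open>\<eta>\<close> the one
  where the Armijo condition first holds with equality, so that the scaling of the search direction
  disappears. The last clause covers both ways in which backtracking can stop: at the initial trial
  step, or after a rejected step beyond \<open>\<eta>\<close>.\<close>

lemma line_search_step_cases:
  assumes x: "x \<in> M" and step: "line_search_step M f R \<omega> \<beta> c x x'"
  obtains (stationary) "g x = 0" and "x' = x"
  | (descent) \<zeta> \<eta> where "g x > 0" and "\<zeta> \<in> T x" and "\<eta> \<in> T x" and "\<eta> \<noteq> 0" and "x' = R x \<zeta>"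
      and "f x' - f x \<le> c * (grad f x \<bullet> \<zeta>)" and "grad f x \<bullet> \<zeta> \<le> - \<omega> * g x * norm \<zeta>"
      and "f (R x \<eta>) - f x = c * (grad f x \<bullet> \<eta>)" and "grad f x \<bullet> \<eta> \<le> - \<omega> * g x * norm \<eta>"
      and "\<beta> * min (g x) (norm \<eta>) \<le> norm \<zeta>"
proof -
  obtain \<xi> where \<xi>: "\<xi> \<in> T x" and angle: "grad f x \<bullet> \<xi> \<le> - \<omega> * g x * norm \<xi>"
    and zero: "\<xi> = 0 \<longleftrightarrow> g x = 0" "\<xi> = 0 \<Longrightarrow> x' = x"
    and nz: "\<xi> \<noteq> 0 \<Longrightarrow> \<exists>b. b \<ge> min (g x / norm \<xi>) (first_armijo_equality f R c x \<xi>) \<and>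
                x' = R x (armijo_step_size f R \<beta> c x \<xi> b *\<^sub>R \<xi>)"
    using step unfolding line_search_step_def by blast
  show thesis
  proof (cases "\<xi> = 0")
    case True
    then show ?thesis using zero stationary by blast
  next
    case False
    then have gpos: "g x > 0" using zero(1) proj_antigrad_norm_nonneg[OF x, of f] by linarith
    have n: "norm \<xi> > 0" using False by simp
    obtain b where b: "b \<ge> min (g x / norm \<xi>) (first_armijo_equality f R c x \<xi>)"
      and x': "x' = R x (armijo_step_size f R \<beta> c x \<xi> b *\<^sub>R \<xi>)"
      using nz[OF False] by blast
    define h where "h \<alpha> = f (R x (\<alpha> *\<^sub>R \<xi>)) - f x" for \<alpha>
    let ?s = "grad f x \<bullet> \<xi>"
    have "\<omega> * g x * norm \<xi> > 0" using \<omega> gpos n by simp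
    then have s: "?s < 0" using angle by linarith
    have "continuous_on {0..} (\<lambda>\<alpha>. R x (\<alpha> *\<^sub>R \<xi>))"
      using retraction x \<xi> unfolding tangent_cone_retraction_def by blast
    moreover have RM: "R x (\<alpha> *\<^sub>R \<xi>) \<in> M" if "\<alpha> \<ge> 0" for \<alpha>
      using R_in_M[OF x T_scale[OF x \<xi> that]] .
    ultimately have cont: "continuous_on {0..} h"
      unfolding h_def by (intro continuous_intros continuous_on_compose2[OF continuous_f]) auto
    have slope: "((\<lambda>\<alpha>. h \<alpha> / \<alpha>) \<longlongrightarrow> ?s) (at_right 0)"
      unfolding h_def by (rule retraction_slope[OF x \<xi>])
    have lower: "B - f x \<le> h \<alpha>" if "\<alpha> \<ge> 0" for \<alpha>
      using below[OF RM[OF that]] by (simp add: h_def)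
    have \<gamma>: "g x / norm \<xi> > 0" using gpos n by simp
    define \<alpha>\<^sub>0 where "\<alpha>\<^sub>0 = first_armijo_equality f R c x \<xi>"
    define \<alpha>\<^sub>1 where "\<alpha>\<^sub>1 = armijo_step_size f R \<beta> c x \<xi> b"
    have \<alpha>0: "\<alpha>\<^sub>0 = (LEAST \<alpha>. \<alpha> > 0 \<and> h \<alpha> = c * \<alpha> * ?s)"
      and \<alpha>1: "\<alpha>\<^sub>1 = (GREATEST \<alpha>. \<exists>m::nat. \<alpha> = \<beta> ^ m * b \<and> h \<alpha> \<le> c * \<alpha> * ?s)"
      by (simp_all add: \<alpha>\<^sub>0_def \<alpha>\<^sub>1_def first_armijo_equality_def armijo_step_size_def h_def)
    have b': "b \<ge> min (g x / norm \<xi>) \<alpha>\<^sub>0" using b by (simp add: \<alpha>\<^sub>0_def)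
    note A = armijo_search[OF cont slope s lower c \<beta> \<gamma> b'[unfolded \<alpha>0], folded \<alpha>0 \<alpha>1]
    have "0 \<le> \<beta> * min (g x / norm \<xi>) \<alpha>\<^sub>0" using \<beta> \<gamma> A(1) by simp
    then have \<alpha>1_nonneg: "\<alpha>\<^sub>1 \<ge> 0" using A(4) by linarith
    have scaled: "grad f x \<bullet> (\<alpha> *\<^sub>R \<xi>) \<le> - \<omega> * g x * norm (\<alpha> *\<^sub>R \<xi>)" if "\<alpha> \<ge> 0" for \<alpha>
      using mult_left_mono[OF angle that] that by (simp add: ac_simps)
    show ?thesis
    proof (rule descent[of "\<alpha>\<^sub>1 *\<^sub>R \<xi>" "\<alpha>\<^sub>0 *\<^sub>R \<xi>"])
      show "g x > 0" by (rule gpos)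
      show "\<alpha>\<^sub>1 *\<^sub>R \<xi> \<in> T x" "\<alpha>\<^sub>0 *\<^sub>R \<xi> \<in> T x" using T_scale[OF x \<xi>] \<alpha>1_nonneg A(1) by auto
      show "\<alpha>\<^sub>0 *\<^sub>R \<xi> \<noteq> 0" using A(1) False by simp
      show "x' = R x (\<alpha>\<^sub>1 *\<^sub>R \<xi>)" using x' by (simp add: \<alpha>\<^sub>1_def)
      then show "f x' - f x \<le> c * (grad f x \<bullet> (\<alpha>\<^sub>1 *\<^sub>R \<xi>))" using A(3) by (simp add: h_def ac_simps)
      show "f (R x (\<alpha>\<^sub>0 *\<^sub>R \<xi>)) - f x = c * (grad f x \<bullet> (\<alpha>\<^sub>0 *\<^sub>R \<xi>))" using A(2) by (simp add: h_def ac_simps)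
      show "grad f x \<bullet> (\<alpha>\<^sub>1 *\<^sub>R \<xi>) \<le> - \<omega> * g x * norm (\<alpha>\<^sub>1 *\<^sub>R \<xi>)"
        "grad f x \<bullet> (\<alpha>\<^sub>0 *\<^sub>R \<xi>) \<le> - \<omega> * g x * norm (\<alpha>\<^sub>0 *\<^sub>R \<xi>)"
        using scaled \<alpha>1_nonneg A(1) by auto
      have "\<beta> * min (g x) (norm (\<alpha>\<^sub>0 *\<^sub>R \<xi>)) = (\<beta> * min (g x / norm \<xi>) \<alpha>\<^sub>0) * norm \<xi>"
        using n A(1) by (simp add: min_mult_distrib_right min_def field_simps)
      also have "\<dots> \<le> \<alpha>\<^sub>1 * norm \<xi>" using A(4) n by (intro mult_right_mono) auto
      finally show "\<beta> * min (g x) (norm (\<alpha>\<^sub>0 *\<^sub>R \<xi>)) \<le> norm (\<alpha>\<^sub>1 *\<^sub>R \<xi>)" using \<alpha>1_nonneg by simp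
    qed
  qed
qed

lemma step_in_M:
  assumes "x \<in> M" and "line_search_step M f R \<omega> \<beta> c x x'" shows "x' \<in> M"
  using assms by (cases rule: line_search_step_cases) (use assms(1) R_in_M in auto)

lemma sufficient_decrease:
  assumes x: "x \<in> M" and "line_search_step M f R \<omega> \<beta> c x x'"
  shows "f x' - f x \<le> - (c * \<omega> / C) * g x * norm (x' - x)"
  using assms
proof (cases rule: line_search_step_cases)
  case (descent \<zeta> \<eta>)
  have "norm (x' - x) \<le> C * norm \<zeta>" using linear_bound[OF x descent(2)] descent(5) by simp
  then have "(c * \<omega> / C * g x) * norm (x' - x) \<le> (c * \<omega> / C * g x) * (C * norm \<zeta>)"
    using c \<omega> C descent(1) by (intro mult_left_mono) auto
  also have "\<dots> = c * (\<omega> * g x * norm \<zeta>)" using C by simp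
  also have "\<dots> \<le> c * - (grad f x \<bullet> \<zeta>)" using descent(7) c by (intro mult_left_mono) auto
  also have "\<dots> \<le> - (f x' - f x)" using descent(6) by simp
  finally show ?thesis by simp
qed simp

lemma step_stationary:
  assumes "x \<in> M" and "line_search_step M f R \<omega> \<beta> c x x'" and "g x = 0" shows "x' = x"
  using assms(1,2) by (cases rule: line_search_step_cases) (use assms(3) in auto)

text \<open>At the equality displacement \<open>\<eta>\<close> the objective exceeds its linear model by
  \<open>(1 - c) * - (grad f x \<bullet> \<eta>)\<close>, which the angle condition bounds below by a multiple of \<open>g x * norm \<eta>\<close>. For
  small \<open>\<eta>\<close> this excess is \<open>O((norm \<eta>)\<^sup>2)\<close>, which makes \<open>norm \<eta>\<close>, and hence \<open>norm \<zeta>\<close>, at least a multiple of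
  \<open>g x\<close>. If \<open>\<zeta>\<close> is small, the retraction moves by at least \<open>norm \<zeta> / 2\<close>. If \<open>\<zeta>\<close> is large, the retracted
  point might still be close to \<open>x\<close>; but then the guaranteed decrease, a multiple of \<open>g x\<close>, can
  only be reached over a distance of that order, since \<open>f\<close> is locally Lipschitz.\<close>

lemma step_length_lower_bound:
  assumes r: "r > 0" and K: "K \<ge> 1"
    and q: "quadratic_expansion f (\<lambda>u h. grad f u \<bullet> h) (ball p r) K"
    and so: "\<And>x \<xi>. x \<in> M \<Longrightarrow> x \<in> ball p r \<Longrightarrow> \<xi> \<in> T x \<Longrightarrow> norm \<xi> < r \<Longrightarrow>
        norm (R x \<xi> - (x + \<xi>)) \<le> K * (norm \<xi>)\<^sup>2"
  shows "\<exists>\<kappa>>0. \<forall>x\<in>M \<inter> ball p (r/2). \<forall>x'. line_search_step M f R \<omega> \<beta> c x x' \<longrightarrow>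
      \<kappa> * g x \<le> norm (x' - x)"
proof -
  \<comment> \<open>Displacements shorter than \<open>t\<close> count as small: they keep the retracted point in the ball and
    the retraction error below half of their length.\<close>
  define t where "t = min (r / (2 * C)) (1 / (2 * K))"
  have t: "t > 0" "t \<le> r / (2 * C)" "t \<le> 1 / (2 * K)" using r C K by (auto simp: t_def)
  have tr: "t < r"
  proof -
    have "r / (2 * C) < r" using r C by (simp add: divide_less_eq)
    then show ?thesis using t(2) by linarith
  qed
  define K' where "K' = K * K + K * C\<^sup>2"
  have K': "K' > 0" using K by (simp add: K'_def add_pos_nonneg)
  \<comment> \<open>The constants bound \<open>norm \<eta> / g x\<close>, \<open>norm \<zeta> / g x\<close>, and the step for large \<open>\<zeta>\<close>, in this order.\<close>
  define \<kappa>\<^sub>1 where "\<kappa>\<^sub>1 = min ((1 - c) * \<omega> / K') (t / K)"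
  have \<kappa>1: "\<kappa>\<^sub>1 > 0" using c \<omega> K K' t by (simp add: \<kappa>\<^sub>1_def)
  define \<kappa>\<^sub>2 where "\<kappa>\<^sub>2 = \<beta> * min 1 \<kappa>\<^sub>1"
  have \<kappa>2: "\<kappa>\<^sub>2 > 0" using \<beta> \<kappa>1 by (simp add: \<kappa>\<^sub>2_def)
  define \<kappa>\<^sub>3 where "\<kappa>\<^sub>3 = c * \<omega> * t / (K * (1 + r))"
  have \<kappa>3: "\<kappa>\<^sub>3 > 0" using c \<omega> K r t by (simp add: \<kappa>\<^sub>3_def)
  define \<kappa> where "\<kappa> = min (\<kappa>\<^sub>2 / 2) (min (r / (2 * K)) \<kappa>\<^sub>3)"
  have \<kappa>: "\<kappa> > 0" "\<kappa> \<le> \<kappa>\<^sub>2 / 2" "\<kappa> \<le> r / (2 * K)" "\<kappa> \<le> \<kappa>\<^sub>3"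
    using \<kappa>2 \<kappa>3 r K by (auto simp: \<kappa>_def)
  have "\<kappa> * g x \<le> norm (x' - x)"
    if x: "x \<in> M" and xr: "x \<in> ball p (r/2)" and step: "line_search_step M f R \<omega> \<beta> c x x'" for x x'
    using x step
  proof (cases rule: line_search_step_cases)
    case (descent \<zeta> \<eta>)
    have xr': "x \<in> ball p r" using xr r by auto
    note D = quadratic_expansionD[OF q xr']
    have near: "y \<in> ball p r" if "norm (y - x) < r/2" for y
      using that xr dist_triangle[of p y x] by (simp add: dist_norm norm_minus_commute)
    have "norm (grad f x) \<le> K"
    proof (cases "grad f x = 0")
      case False
      have "norm (grad f x) * norm (grad f x) \<le> K * norm (grad f x)"
        using D(2)[of "grad f x"] by (simp add: norm_eq_sqrt_inner)
      then show ?thesis using False by simp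
    qed (use K in simp)
    then have gK: "g x \<le> K" using proj_antigrad_norm_le_norm_grad[of M f x] by linarith
    have small: "norm (R x \<xi> - (x + \<xi>)) \<le> K * (norm \<xi>)\<^sup>2" "R x \<xi> \<in> ball p r"
      if "\<xi> \<in> T x" "norm \<xi> < t" for \<xi>
    proof -
      show "norm (R x \<xi> - (x + \<xi>)) \<le> K * (norm \<xi>)\<^sup>2" using so[OF x xr' that(1)] that(2) tr by simp
      have "norm (R x \<xi> - x) \<le> C * norm \<xi>" by (rule linear_bound[OF x that(1)])
      also have "\<dots> < C * (r / (2 * C))" using that(2) t(2) C by (intro mult_strict_left_mono) auto
      finally show "R x \<xi> \<in> ball p r" using C by (intro near) simp
    qed
    have \<eta>: "\<kappa>\<^sub>1 * g x \<le> norm \<eta>"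
    proof (cases "norm \<eta> < t")
      case True
      define e where "e = R x \<eta> - (x + \<eta>)"
      have e: "norm e \<le> K * (norm \<eta>)\<^sup>2" unfolding e_def by (rule small(1)[OF descent(3) True])
      have "f (R x \<eta>) - f x - grad f x \<bullet> (R x \<eta> - x) \<le> K * (norm (R x \<eta> - x))\<^sup>2"
        using D(3)[OF small(2)[OF descent(3) True]] by simp
      also have "\<dots> \<le> K * (C * norm \<eta>)\<^sup>2"
        using linear_bound[OF x descent(3)] K by (intro mult_left_mono power_mono) auto
      finally have 1: "f (R x \<eta>) - f x - grad f x \<bullet> (R x \<eta> - x) \<le> K * C\<^sup>2 * (norm \<eta>)\<^sup>2"
        by (simp add: power_mult_distrib)
      have "\<bar>grad f x \<bullet> e\<bar> \<le> K * (K * (norm \<eta>)\<^sup>2)"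
        using order_trans[OF D(2)[of e] mult_left_mono[OF e, of K]] K by simp
      moreover have "grad f x \<bullet> (R x \<eta> - x) = grad f x \<bullet> \<eta> + grad f x \<bullet> e"
        by (simp add: e_def algebra_simps flip: inner_add_right)
      ultimately have "(1 - c) * - (grad f x \<bullet> \<eta>) \<le> K' * (norm \<eta>)\<^sup>2"
        using 1 descent(8) by (simp add: K'_def algebra_simps abs_le_iff)
      moreover have "(1 - c) * (\<omega> * g x * norm \<eta>) \<le> (1 - c) * - (grad f x \<bullet> \<eta>)"
        using descent(9) c by (intro mult_left_mono) auto
      ultimately have "((1 - c) * \<omega> * g x) * norm \<eta> \<le> (K' * norm \<eta>) * norm \<eta>"
        by (simp add: power2_eq_square algebra_simps)
      then have "(1 - c) * \<omega> * g x \<le> K' * norm \<eta>" using descent(4) by simp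
      then have "(1 - c) * \<omega> / K' * g x \<le> norm \<eta>" using K' by (simp add: field_simps)
      moreover have "\<kappa>\<^sub>1 * g x \<le> (1 - c) * \<omega> / K' * g x"
        using descent(1) by (intro mult_right_mono) (auto simp: \<kappa>\<^sub>1_def)
      ultimately show ?thesis by linarith
    next
      case False
      have "\<kappa>\<^sub>1 * g x \<le> t / K * K"
        using gK descent(1) t K \<kappa>1 by (intro mult_mono) (auto simp: \<kappa>\<^sub>1_def)
      then show ?thesis using False K by simp
    qed
    have \<zeta>: "\<kappa>\<^sub>2 * g x \<le> norm \<zeta>"
    proof -
      have "min 1 \<kappa>\<^sub>1 * g x \<le> min (g x) (norm \<eta>)"
      proof (rule min.boundedI)
        show "min 1 \<kappa>\<^sub>1 * g x \<le> g x" using descent(1) mult_right_mono[of "min 1 \<kappa>\<^sub>1" 1 "g x"] by simp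
        have "min 1 \<kappa>\<^sub>1 * g x \<le> \<kappa>\<^sub>1 * g x" using descent(1) by (intro mult_right_mono) auto
        then show "min 1 \<kappa>\<^sub>1 * g x \<le> norm \<eta>" using \<eta> by linarith
      qed
      from order_trans[OF mult_left_mono[OF this, of \<beta>] descent(10)] show ?thesis
        using \<beta> by (simp add: \<kappa>\<^sub>2_def mult.assoc)
    qed
    show ?thesis
    proof (cases "norm \<zeta> < t")
      case True
      have "K * norm \<zeta> \<le> K * (1 / (2 * K))" using True t(3) K by (intro mult_left_mono) auto
      then have "K * norm \<zeta> \<le> 1/2" using K by simp
      from mult_right_mono[OF this, of "norm \<zeta>"]
      have "norm (x' - (x + \<zeta>)) \<le> norm \<zeta> / 2"
        using small(1)[OF descent(2) True] descent(5) by (simp add: power2_eq_square)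
      moreover have "norm \<zeta> \<le> norm (x' - x) + norm (x' - (x + \<zeta>))"
        using norm_triangle_ineq4[of "x' - x" "x' - (x + \<zeta>)"] by simp
      ultimately have "norm \<zeta> / 2 \<le> norm (x' - x)" by simp
      moreover have "\<kappa> * g x \<le> \<kappa>\<^sub>2 / 2 * g x" using \<kappa>(2) descent(1) by (intro mult_right_mono) auto
      ultimately show ?thesis using \<zeta> by simp
    next
      case False
      show ?thesis
      proof (cases "norm (x' - x) < r/2")
        case True
        have "\<bar>f x' - f x - grad f x \<bullet> (x' - x)\<bar> \<le> K * (norm (x' - x))\<^sup>2"
          using D(3)[OF near[OF True]] by simp
        moreover have "K * (norm (x' - x))\<^sup>2 \<le> K * (r * norm (x' - x))"
          unfolding power2_eq_square using True r K by (intro mult_left_mono mult_right_mono) auto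
        moreover have "\<bar>grad f x \<bullet> (x' - x)\<bar> \<le> K * norm (x' - x)" using D(2)[of "x' - x"] by simp
        ultimately have "- (f x' - f x) \<le> K * norm (x' - x) + K * (r * norm (x' - x))" by linarith
        then have up: "- (f x' - f x) \<le> K * (1 + r) * norm (x' - x)" by (simp add: algebra_simps)
        have "c * (\<omega> * g x * t) \<le> c * (\<omega> * g x * norm \<zeta>)"
          using c \<omega> descent(1) False by (intro mult_left_mono) auto
        also have "\<dots> \<le> c * - (grad f x \<bullet> \<zeta>)" using descent(7) c by (intro mult_left_mono) auto
        also have "\<dots> \<le> - (f x' - f x)" using descent(6) by simp
        also note up
        finally have "c * (\<omega> * g x * t) / (K * (1 + r)) \<le> norm (x' - x)"
          using K r by (subst pos_divide_le_eq) (simp_all add: mult.commute)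
        then have "\<kappa>\<^sub>3 * g x \<le> norm (x' - x)" by (simp add: \<kappa>\<^sub>3_def ac_simps)
        moreover have "\<kappa> * g x \<le> \<kappa>\<^sub>3 * g x" using \<kappa>(4) descent(1) by (intro mult_right_mono) auto
        ultimately show ?thesis by linarith
      next
        case False
        have "\<kappa> * g x \<le> r / (2 * K) * K" using \<kappa> gK descent(1) K r by (intro mult_mono) auto
        then show ?thesis using False K by simp
      qed
    qed
  qed simp
  then show ?thesis using \<kappa>(1) by (intro exI[of _ \<kappa>]) auto
qed

end

section \<open>Convergence and rates from the Lojasiewicz inequality\<close>

text \<open>This is the tangent inequality of the concave function \<open>t \<mapsto> t powr \<theta>\<close> at \<open>r\<close>, multiplied by
  \<open>r powr (1 - \<theta>)\<close> so that it holds at \<open>r = 0\<close> as well. It reduces to convexity of \<open>exp\<close>.\<close>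

lemma powr_increment_bound:
  fixes r s \<theta> :: real
  assumes "0 \<le> s" and "s \<le> r" and \<theta>: "0 < \<theta>" "\<theta> \<le> 1"
  shows "\<theta> * (r - s) \<le> r powr (1 - \<theta>) * (r powr \<theta> - s powr \<theta>)"
proof (cases "r = 0")
  case False
  then have r: "r > 0" using assms by linarith
  define t where "t = s / r"
  have t: "0 \<le> t" "t \<le> 1" and s: "s = r * t" using assms r by (auto simp: t_def)
  have "t powr \<theta> \<le> 1 - \<theta> + \<theta> * t"
  proof (cases "t = 0")
    case False
    then have "t > 0" using t by simp
    have "exp ((1 - \<theta>) *\<^sub>R 0 + \<theta> *\<^sub>R ln t) \<le> (1 - \<theta>) * exp 0 + \<theta> * exp (ln t)"
      by (rule convex_onD[OF exp_convex]) (use \<theta> in auto)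
    then show ?thesis using \<open>t > 0\<close> by (simp add: powr_def)
  qed (use \<theta> in auto)
  then have "\<theta> * (1 - t) \<le> 1 - t powr \<theta>" by (simp add: algebra_simps)
  then have "r * (\<theta> * (1 - t)) \<le> r * (1 - t powr \<theta>)" using r by (intro mult_left_mono) auto
  also have "\<dots> = r powr (1 - \<theta>) * (r powr \<theta> - s powr \<theta>)"
  proof -
    have "r powr (1 - \<theta>) * r powr \<theta> = r" using r by (simp flip: powr_add)
    moreover have "s powr \<theta> = r powr \<theta> * t powr \<theta>" using r t by (simp add: s powr_mult)
    ultimately have "r powr (1 - \<theta>) * (r powr \<theta> - s powr \<theta>) = r - r * t powr \<theta>"
      by (simp add: right_diff_distrib flip: mult.assoc)
    then show ?thesis by (simp add: right_diff_distrib)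
  qed
  finally show ?thesis by (simp add: s algebra_simps)
qed (use assms in auto)

text \<open>The potential \<open>\<Phi> n = C * r n powr \<theta>\<close> pays for the path: near \<open>p\<close>, each step is at most the drop of
  \<open>\<Phi>\<close>. Once an iterate is within \<open>\<delta> / 2\<close> of \<open>p\<close> with \<open>\<Phi> < \<delta> / 2\<close>, the remaining path is too short to leave the
  \<open>\<delta>\<close>-ball. The path from step \<open>m\<close> on is thus no longer than \<open>\<Phi> m\<close>, and evaluating it along the
  subsequence that converges to \<open>p\<close> bounds \<open>norm (x m - p)\<close>.\<close>

lemma Lojasiewicz_trajectory_bound:
  fixes x :: "nat \<Rightarrow> 'a::real_normed_vector" and r g :: "nat \<Rightarrow> real"
  assumes cluster: "cluster_point x p"
    and r_nonneg: "\<And>n. 0 \<le> r n" and r0: "r \<longlonglongrightarrow> 0" and g: "\<And>n. 0 \<le> g n"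
    and decrease: "\<And>n. r (Suc n) - r n \<le> - \<sigma> * g n * norm (x (Suc n) - x n)" and \<sigma>: "\<sigma> > 0"
    and stationary: "\<And>n. g n = 0 \<Longrightarrow> x (Suc n) = x n"
    and Loj: "\<And>n. norm (x n - p) < \<delta> \<Longrightarrow> r n powr (1 - \<theta>) \<le> \<Lambda> * g n"
    and \<delta>: "\<delta> > 0" and \<Lambda>: "\<Lambda> > 0" and \<theta>: "0 < \<theta>" "\<theta> \<le> 1"
  shows "\<exists>n\<^sub>0. \<exists>C>0. \<forall>n\<ge>n\<^sub>0. norm (x n - p) < \<delta> \<and> norm (x n - p) \<le> C * r n powr \<theta>"
proof -
  define C where "C = \<Lambda> / (\<sigma> * \<theta>)"
  have C: "C > 0" using \<Lambda> \<sigma> \<theta> by (simp add: C_def)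
  define \<Phi> where "\<Phi> n = C * r n powr \<theta>" for n
  have \<Phi>_nonneg: "\<Phi> n \<ge> 0" for n using C by (simp add: \<Phi>_def)
  have dec: "r (Suc n) \<le> r n" for n
    using decrease[of n] mult_nonneg_nonneg[OF mult_nonneg_nonneg[OF less_imp_le[OF \<sigma>] g[of n]] norm_ge_zero[of "x (Suc n) - x n"]]
    by simp
  have length: "norm (x (Suc n) - x n) \<le> \<Phi> n - \<Phi> (Suc n)" if near: "norm (x n - p) < \<delta>" for n
  proof (cases "g n = 0")
    case True
    have "r (Suc n) powr \<theta> \<le> r n powr \<theta>" using dec r_nonneg \<theta> by (intro powr_mono2) auto
    then show ?thesis using stationary[OF True] C by (simp add: \<Phi>_def)
  next
    case False
    then have gp: "g n > 0" using g[of n] by simp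
    have mono: "r (Suc n) powr \<theta> \<le> r n powr \<theta>" using dec r_nonneg \<theta> by (intro powr_mono2) auto
    have "\<theta> * (\<sigma> * g n * norm (x (Suc n) - x n)) \<le> \<theta> * (r n - r (Suc n))"
      using decrease[of n] \<theta> by (intro mult_left_mono) auto
    also have "\<dots> \<le> r n powr (1 - \<theta>) * (r n powr \<theta> - r (Suc n) powr \<theta>)"
      by (rule powr_increment_bound[OF r_nonneg dec \<theta>])
    also have "\<dots> \<le> (\<Lambda> * g n) * (r n powr \<theta> - r (Suc n) powr \<theta>)"
      using Loj[OF near] mono by (intro mult_right_mono) auto
    finally have "g n * (\<theta> * \<sigma> * norm (x (Suc n) - x n)) \<le> g n * (\<Lambda> * (r n powr \<theta> - r (Suc n) powr \<theta>))"
      by (simp add: ac_simps)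
    then have "\<theta> * \<sigma> * norm (x (Suc n) - x n) \<le> \<Lambda> * (r n powr \<theta> - r (Suc n) powr \<theta>)" using gp by simp
    then show ?thesis using \<theta> \<sigma> by (simp add: \<Phi>_def C_def field_simps)
  qed
  have \<Phi>0: "\<Phi> \<longlonglongrightarrow> 0"
  proof -
    have "(\<lambda>n. r n powr \<theta>) \<longlonglongrightarrow> 0 powr \<theta>"
      using r_nonneg \<theta> by (intro tendsto_powr'[OF r0 tendsto_const]) auto
    then have "(\<lambda>n. C * r n powr \<theta>) \<longlonglongrightarrow> 0" by (intro tendsto_mult_right_zero) simp
    then show ?thesis by (simp add: \<Phi>_def[abs_def])
  qed
  obtain \<rho> where \<rho>: "strict_mono \<rho>" "(x \<circ> \<rho>) \<longlonglongrightarrow> p" using cluster unfolding cluster_point_def by blast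
  have "\<forall>\<^sub>F k in sequentially. norm (x (\<rho> k) - p) < \<delta> / 2"
    using tendstoD[OF \<rho>(2), of "\<delta>/2"] \<delta> by (simp add: dist_norm)
  moreover have "\<forall>\<^sub>F k in sequentially. \<Phi> (\<rho> k) < \<delta> / 2"
    using order_tendstoD(2)[OF LIMSEQ_subseq_LIMSEQ[OF \<Phi>0 \<rho>(1)], of "\<delta>/2"] \<delta> by (simp add: o_def)
  ultimately have "\<forall>\<^sub>F k in sequentially. norm (x (\<rho> k) - p) < \<delta> / 2 \<and> \<Phi> (\<rho> k) < \<delta> / 2"
    by (rule eventually_conj)
  then obtain k where k: "norm (x (\<rho> k) - p) < \<delta> / 2" "\<Phi> (\<rho> k) < \<delta> / 2"
    by (auto simp: eventually_sequentially)
  define n\<^sub>0 where "n\<^sub>0 = \<rho> k"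
  have trap: "norm (x n - p) < \<delta> \<and> norm (x n - x n\<^sub>0) \<le> \<Phi> n\<^sub>0 - \<Phi> n" if "n \<ge> n\<^sub>0" for n
    using that
  proof (induction n rule: dec_induct)
    case base
    then show ?case using k \<delta> by (simp add: n\<^sub>0_def)
  next
    case (step n)
    have "norm (x (Suc n) - x n\<^sub>0) \<le> norm (x (Suc n) - x n) + norm (x n - x n\<^sub>0)"
      using norm_triangle_ineq[of "x (Suc n) - x n" "x n - x n\<^sub>0"] by simp
    then have 1: "norm (x (Suc n) - x n\<^sub>0) \<le> \<Phi> n\<^sub>0 - \<Phi> (Suc n)"
      using length[of n] step.IH by linarith
    have "norm (x (Suc n) - p) \<le> norm (x (Suc n) - x n\<^sub>0) + norm (x n\<^sub>0 - p)"
      using norm_triangle_ineq[of "x (Suc n) - x n\<^sub>0" "x n\<^sub>0 - p"] by simp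
    then have "norm (x (Suc n) - p) < \<delta>" using 1 k \<Phi>_nonneg[of "Suc n"] by (simp add: n\<^sub>0_def)
    with 1 show ?case by simp
  qed
  have tail: "norm (x n - x m) \<le> \<Phi> m - \<Phi> n" if "m \<ge> n\<^sub>0" "n \<ge> m" for n m
    using that(2)
  proof (induction n rule: dec_induct)
    case (step n)
    have "norm (x (Suc n) - x m) \<le> norm (x (Suc n) - x n) + norm (x n - x m)"
      using norm_triangle_ineq[of "x (Suc n) - x n" "x n - x m"] by simp
    moreover have "norm (x n - p) < \<delta>" using trap[of n] step.hyps that(1) by simp
    ultimately show ?case
      using length[of n] step.IH by linarith
  qed simp
  have "norm (x m - p) \<le> \<Phi> m" if m: "m \<ge> n\<^sub>0" for m
  proof -
    have "norm (p - x m) \<le> \<Phi> m"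
    proof (rule tendsto_upperbound[OF _ _ sequentially_bot])
      show "(\<lambda>k. norm ((x \<circ> \<rho>) k - x m)) \<longlonglongrightarrow> norm (p - x m)" by (intro tendsto_intros \<rho>)
      show "\<forall>\<^sub>F k in sequentially. norm ((x \<circ> \<rho>) k - x m) \<le> \<Phi> m"
        using eventually_ge_at_top[of m]
      proof (rule eventually_mono)
        fix k assume "k \<ge> m"
        then have "\<rho> k \<ge> m" using seq_suble[OF \<rho>(1), of k] by linarith
        then show "norm ((x \<circ> \<rho>) k - x m) \<le> \<Phi> m" using tail[OF m, of "\<rho> k"] \<Phi>_nonneg[of "\<rho> k"] by simp
      qed
    qed
    then show ?thesis by (simp add: norm_minus_commute)
  qed
  then show ?thesis using trap C unfolding \<Phi>_def by blast
qed

lemma geometric_decay: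
  fixes r :: "nat \<Rightarrow> real"
  assumes r: "\<And>n. 0 \<le> r n" and step: "\<And>n. n \<ge> n\<^sub>0 \<Longrightarrow> r (Suc n) \<le> r n - \<mu> * r n" and "n \<ge> n\<^sub>0"
  shows "r n \<le> r n\<^sub>0 * exp (- \<mu> * real (n - n\<^sub>0))"
  using assms(3)
proof (induction n rule: dec_induct)
  case (step n)
  have "r (Suc n) \<le> r n * (1 - \<mu>)" using assms(2)[of n] step.hyps by (simp add: algebra_simps)
  also have "\<dots> \<le> r n * exp (- \<mu>)" using r[of n] exp_ge_add_one_self[of "-\<mu>"] by (intro mult_left_mono) auto
  also have "\<dots> \<le> r n\<^sub>0 * exp (- \<mu> * real (n - n\<^sub>0)) * exp (- \<mu>)" using step.IH by (intro mult_right_mono) auto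
  also have "\<dots> = r n\<^sub>0 * exp (- \<mu> * real (Suc n - n\<^sub>0))"
    using step.hyps by (simp add: Suc_diff_le algebra_simps flip: exp_add)
  finally show ?case .
qed simp

text \<open>The substitution \<open>r powr (- q)\<close> linearizes the recursion: writing \<open>r (Suc n) \<le> r n * (1 - y)\<close> with
  \<open>y = \<mu> * r n powr q\<close>, Bernoulli's inequality for the negative exponent \<open>- q\<close> shows that each step adds
  at least \<open>q * \<mu>\<close>.\<close>

lemma negative_powr_growth:
  fixes r :: "nat \<Rightarrow> real"
  assumes r: "\<And>n. 0 \<le> r n" and step: "\<And>n. n \<ge> n\<^sub>0 \<Longrightarrow> r (Suc n) \<le> r n - \<mu> * r n powr (1 + q)"
    and \<mu>: "\<mu> > 0" and q: "q > 0" and "n \<ge> n\<^sub>0" and "r n > 0"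
  shows "q * \<mu> * real (n - n\<^sub>0) \<le> r n powr (- q)"
  using assms(5,6)
proof (induction n rule: dec_induct)
  case (step n)
  have st: "r (Suc n) \<le> r n - \<mu> * r n powr (1 + q)" using assms(2) step.hyps by simp
  have "\<mu> * r n powr (1 + q) \<ge> 0" using \<mu> by simp
  then have rn: "r n > 0" using st step.prems by linarith
  define y where "y = \<mu> * r n powr q"
  have y: "y > 0" using \<mu> rn by (simp add: y_def)
  have st': "r (Suc n) \<le> r n * (1 - y)" using st rn by (simp add: y_def powr_add algebra_simps)
  then have "0 < r n * (1 - y)" using step.prems by linarith
  then have y1: "y < 1" using rn by (simp add: zero_less_mult_iff)
  have "1 + q * y \<le> (1 - y) powr (- q)"
  proof -
    have "ln (1 - y) \<le> - y" using ln_le_minus_one[of "1 - y"] y1 by simp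
    from mult_left_mono[OF this, of q] have "q * y \<le> - q * ln (1 - y)" using q by simp
    then show ?thesis using exp_ge_add_one_self[of "- q * ln (1 - y)"] y1 by (simp add: powr_def)
  qed
  then have "r n powr (- q) * (1 + q * y) \<le> r n powr (- q) * (1 - y) powr (- q)" by (intro mult_left_mono) auto
  also have "\<dots> = (r n * (1 - y)) powr (- q)" using rn y1 by (simp add: powr_mult)
  also have "\<dots> \<le> r (Suc n) powr (- q)" using st' step.prems q by (intro powr_mono2') auto
  finally have "r n powr (- q) * (1 + q * y) \<le> r (Suc n) powr (- q)" .
  moreover have "r n powr (- q) * (1 + q * y) = r n powr (- q) + q * \<mu>"
    using rn by (simp add: y_def powr_minus field_simps)
  moreover have "q * \<mu> * real (n - n\<^sub>0) \<le> r n powr (- q)" by (rule step.IH[OF rn])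
  moreover have "q * \<mu> * real (Suc n - n\<^sub>0) = q * \<mu> * real (n - n\<^sub>0) + q * \<mu>"
    using step.hyps by (simp add: Suc_diff_le algebra_simps)
  ultimately show ?case by linarith
qed simp

text \<open>For \<open>n \<ge> 2 * n\<^sub>0\<close> the linear growth in \<open>n - n\<^sub>0\<close> is at least linear growth in \<open>n / 2\<close>, which removes
  the shift from the rate.\<close>

lemma polynomial_decay:
  fixes r :: "nat \<Rightarrow> real"
  assumes r: "\<And>n. 0 \<le> r n" and step: "\<And>n. n \<ge> n\<^sub>0 \<Longrightarrow> r (Suc n) \<le> r n - \<mu> * r n powr (1 + q)"
    and \<mu>: "\<mu> > 0" and q: "q > 0" and n: "n \<ge> 2 * n\<^sub>0" "n \<ge> 1" and \<theta>: "\<theta> > 0"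
  shows "r n powr \<theta> \<le> (q * \<mu> / 2) powr (- (\<theta> / q)) * real n powr (- (\<theta> / q))"
proof (cases "r n = 0")
  case False
  then have rn: "r n > 0" using r[of n] by simp
  have "q * \<mu> / 2 * real n \<le> q * \<mu> * real (n - n\<^sub>0)" using n \<mu> q by (simp add: of_nat_diff)
  also have "\<dots> \<le> r n powr (- q)" using n by (intro negative_powr_growth[OF r step \<mu> q _ rn]) auto
  finally have "(r n powr (- q)) powr (- (\<theta> / q)) \<le> (q * \<mu> / 2 * real n) powr (- (\<theta> / q))"
    using q \<mu> n \<theta> by (intro powr_mono2') auto
  moreover have "(r n powr (- q)) powr (- (\<theta> / q)) = r n powr \<theta>" using q by (simp add: powr_powr)
  moreover have "(q * \<mu> / 2 * real n) powr (- (\<theta> / q)) = (q * \<mu> / 2) powr (- (\<theta> / q)) * real n powr (- (\<theta> / q))"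
    by (rule powr_mult)
  ultimately show ?thesis by simp
qed (use \<theta> in auto)

lemma eventual_bound_extends:
  fixes d e :: "nat \<Rightarrow> real"
  assumes "\<And>n. n \<ge> n\<^sub>1 \<Longrightarrow> d n \<le> C * e n" and "\<And>n. n \<ge> k \<Longrightarrow> e n > 0"
  shows "\<exists>C'>0. \<forall>n\<ge>k. d n \<le> C' * e n"
proof -
  define C' where "C' = 1 + \<bar>C\<bar> + (\<Sum>n<n\<^sub>1. \<bar>d n / e n\<bar>)"
  have S: "(\<Sum>n<n\<^sub>1. \<bar>d n / e n\<bar>) \<ge> 0" by (rule sum_nonneg) auto
  have "d n \<le> C' * e n" if "n \<ge> k" for n
  proof (cases "n \<ge> n\<^sub>1")
    case True
    have "C * e n \<le> C' * e n" using S assms(2)[OF that] by (intro mult_right_mono) (auto simp: C'_def)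
    then show ?thesis using assms(1)[OF True] by linarith
  next
    case False
    then have "\<bar>d n / e n\<bar> \<le> (\<Sum>n<n\<^sub>1. \<bar>d n / e n\<bar>)" by (intro member_le_sum) auto
    then have "d n / e n \<le> C'" unfolding C'_def by linarith
    then show ?thesis using assms(2)[OF that] by (simp add: divide_le_eq)
  qed
  then show ?thesis using S by (intro exI[of _ C']) (auto simp: C'_def)
qed

lemma decseq_cluster_limit:
  fixes F :: "nat \<Rightarrow> real"
  assumes "decseq F" and "strict_mono \<rho>" and lim: "(F \<circ> \<rho>) \<longlonglongrightarrow> l"
  shows "F \<longlonglongrightarrow> l" and "l \<le> F n"
proof -
  have lower: "l \<le> F n" for n
  proof (rule tendsto_upperbound[OF lim _ sequentially_bot])
    show "\<forall>\<^sub>F k in sequentially. (F \<circ> \<rho>) k \<le> F n"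
      using eventually_ge_at_top[of n]
    proof (rule eventually_mono)
      fix k assume "k \<ge> n"
      then show "(F \<circ> \<rho>) k \<le> F n"
        using seq_suble[OF assms(2), of k] decseqD[OF assms(1), of n "\<rho> k"] by simp
    qed
  qed
  then obtain L where L: "F \<longlonglongrightarrow> L" using decseq_convergent[OF assms(1)] by blast
  have "L = l" using LIMSEQ_unique[OF LIMSEQ_subseq_LIMSEQ[OF L assms(2)] lim] .
  then show "F \<longlonglongrightarrow> l" using L by simp
  show "l \<le> F n" by (rule lower)
qed

section \<open>Convergence of the projected line-search method\<close>

theorem corollary2p11:
  fixes D M :: "(real ^ 'n::finite) set"
    and f N :: "real ^ 'n \<Rightarrow> real"
    and R :: "real ^ 'n \<Rightarrow> real ^ 'n \<Rightarrow> real ^ 'n"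
    and \<omega> \<beta> c \<theta> :: real
    and x :: "nat \<Rightarrow> real ^ 'n"
    and xs :: "real ^ 'n"
  assumes "open D" and "closed M" and "M \<subseteq> D"
    and "real_analytic_on f D" and "bdd_below (f ` D)"
    and "tangent_cone_retraction M R" and "linearly_bounded_map M R"
    and "is_norm N" and "metric_projection N M R"
    and "0 < \<omega>" and "\<omega> \<le> 1" and "0 < \<beta>" and "\<beta> < 1" and "0 < c" and "c < 1"
    and "line_search_sequence M f R \<omega> \<beta> c x"
    and "cluster_point x xs"
    and "0 < \<theta>" and "\<theta> \<le> 1 / 2" and "lojasiewicz_at M f \<theta> xs"
    and "\<exists>U. open U \<and> xs \<in> U \<and> smooth_embedded_submanifold (M \<inter> U)"
  shows "(\<exists>\<sigma>>0. \<exists>\<kappa>>0. \<forall>\<^sub>F n in sequentially.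
            f (x (Suc n)) - f (x n)
              \<le> - \<sigma> * proj_antigrad_norm M f (x n) * norm (x (Suc n) - x n) \<and>
            (proj_antigrad_norm M f (x n) = 0 \<longrightarrow> x (Suc n) = x n) \<and>
            norm (x (Suc n) - x n) \<ge> \<kappa> * proj_antigrad_norm M f (x n)) \<and>
         x \<longlonglongrightarrow> xs \<and>
         (\<theta> = 1 / 2 \<longrightarrow>
            (\<exists>a>0. \<exists>C>0. \<forall>n. norm (x n - xs) \<le> C * exp (- a * real n))) \<and>
         (\<theta> < 1 / 2 \<longrightarrow>
            (\<exists>C>0. \<forall>n\<ge>1. norm (x n - xs) \<le> C * real n powr (- (\<theta> / (1 - 2 * \<theta>))))) \<and>
         (\<lambda>n. proj_antigrad_norm M f (x n)) \<longlonglongrightarrow> 0 \<and>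
         proj_antigrad_norm M f xs = 0"
proof -
  note \<theta> = \<open>0 < \<theta>\<close> \<open>\<theta> \<le> 1 / 2\<close>
  define g where "g = proj_antigrad_norm M f"
  obtain B where B: "\<And>y. y \<in> D \<Longrightarrow> B \<le> f y"
    using \<open>bdd_below (f ` D)\<close> by (auto simp: bdd_below_def)
  obtain C' where C': "\<And>y \<xi>. y \<in> M \<Longrightarrow> \<xi> \<in> tangent_cone M y \<Longrightarrow> norm (R y \<xi> - y) \<le> C' * norm \<xi>"
    using \<open>linearly_bounded_map M R\<close> unfolding linearly_bounded_map_def by blast
  define C where "C = max 1 C'"
  interpret armijo_line_search M f R \<omega> \<beta> c B C
  proof
    fix y assume y: "y \<in> M"
    then have yD: "y \<in> D" using \<open>M \<subseteq> D\<close> by blast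
    from real_analytic_quadratic_expansion[OF \<open>real_analytic_on f D\<close> this]
    obtain r K where "r > 0" "quadratic_expansion f (\<lambda>u h. grad f u \<bullet> h) (ball y r) K" by blast
    then have "(f has_derivative (\<lambda>h. grad f y \<bullet> h)) (at y)"
      using quadratic_expansion_has_derivative[of f _ "ball y r" K y] by simp
    then show "GDERIV f y :> grad f y" by (simp add: gderiv_def inner_commute)
    show "B \<le> f y" by (rule B[OF yD])
    fix \<xi> assume "\<xi> \<in> tangent_cone M y"
    have "C' * norm \<xi> \<le> C * norm \<xi>" by (intro mult_right_mono) (auto simp: C_def)
    then show "norm (R y \<xi> - y) \<le> C * norm \<xi>" using C'[OF y \<open>\<xi> \<in> tangent_cone M y\<close>] by linarith
  qed (use assms in \<open>auto simp: C_def\<close>)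

  have step: "line_search_step M f R \<omega> \<beta> c (x n) (x (Suc n))" for n
    using \<open>line_search_sequence M f R \<omega> \<beta> c x\<close> by (simp add: line_search_sequence_def)
  have xM: "x n \<in> M" for n
  proof (induction n)
    case 0 show ?case using \<open>line_search_sequence M f R \<omega> \<beta> c x\<close> by (simp add: line_search_sequence_def)
  next
    case (Suc n) then show ?case using step_in_M step by blast
  qed
  obtain \<rho> where \<rho>: "strict_mono \<rho>" "(x \<circ> \<rho>) \<longlonglongrightarrow> xs"
    using \<open>cluster_point x xs\<close> unfolding cluster_point_def by blast
  have xsM: "xs \<in> M" by (rule closed_sequentially[OF \<open>closed M\<close> _ \<rho>(2)]) (simp add: xM)
  obtain W where W: "open W" "xs \<in> W" "smooth_embedded_submanifold (M \<inter> W)" using assms(21) by blast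

  define \<sigma> where "\<sigma> = c * \<omega> / C"
  have \<sigma>: "\<sigma> > 0" using assms by (simp add: \<sigma>_def C_def)
  have g_nonneg: "g (x n) \<ge> 0" for n unfolding g_def by (rule proj_antigrad_norm_nonneg[OF xM])
  have A1: "f (x (Suc n)) - f (x n) \<le> - \<sigma> * g (x n) * norm (x (Suc n) - x n)" for n
    unfolding \<sigma>_def g_def by (rule sufficient_decrease[OF xM step])
  have A2: "x (Suc n) = x n" if "g (x n) = 0" for n
    using step_stationary[OF xM step] that by (simp add: g_def)

  \<comment> \<open>For the step length, a common ball and a common constant are needed for the expansion of \<open>f\<close> and the
    second-order bound on the projection.\<close>
  obtain r\<^sub>1 K\<^sub>1 where r1: "r\<^sub>1 > 0"
    and q1: "quadratic_expansion f (\<lambda>u h. grad f u \<bullet> h) (ball xs r\<^sub>1) K\<^sub>1"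
    using real_analytic_quadratic_expansion[OF \<open>real_analytic_on f D\<close>, of xs] xsM \<open>M \<subseteq> D\<close> by blast
  obtain r\<^sub>2 K\<^sub>2 where r2: "r\<^sub>2 > 0"
    and so: "\<And>y \<xi>. y \<in> M \<inter> ball xs r\<^sub>2 \<Longrightarrow> \<xi> \<in> tangent_cone M y \<Longrightarrow> norm \<xi> < r\<^sub>2 \<Longrightarrow>
      norm (R y \<xi> - (y + \<xi>)) \<le> K\<^sub>2 * (norm \<xi>)\<^sup>2"
    using metric_projection_second_order[OF \<open>is_norm N\<close> \<open>metric_projection N M R\<close> W(1) xsM W(2,3)] by blast
  define r where "r = min r\<^sub>1 r\<^sub>2"
  define K where "K = max 1 (max K\<^sub>1 K\<^sub>2)"
  have r: "r > 0" "K \<ge> 1" using r1 r2 by (auto simp: r_def K_def)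
  have q: "quadratic_expansion f (\<lambda>u h. grad f u \<bullet> h) (ball xs r) K"
    by (rule quadratic_expansion_mono[OF q1]) (auto simp: r_def K_def)
  have so': "norm (R y \<xi> - (y + \<xi>)) \<le> K * (norm \<xi>)\<^sup>2"
    if "y \<in> M" "y \<in> ball xs r" "\<xi> \<in> tangent_cone M y" "norm \<xi> < r" for y \<xi>
  proof -
    have "norm (R y \<xi> - (y + \<xi>)) \<le> K\<^sub>2 * (norm \<xi>)\<^sup>2" using that by (intro so) (auto simp: r_def)
    also have "\<dots> \<le> K * (norm \<xi>)\<^sup>2" by (intro mult_right_mono) (auto simp: K_def)
    finally show ?thesis .
  qed
  obtain \<kappa> where \<kappa>: "\<kappa> > 0"
    and A3: "\<And>n. x n \<in> ball xs (r/2) \<Longrightarrow> \<kappa> * g (x n) \<le> norm (x (Suc n) - x n)"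
    using step_length_lower_bound[OF r q so'] xM step unfolding g_def by blast

  \<comment> \<open>The values decrease, so their convergence along the subsequence that tends to \<open>xs\<close> carries over to
    the whole sequence.\<close>
  define e where "e n = f (x n) - f xs" for n
  have dec: "decseq (\<lambda>n. f (x n))"
  proof (rule decseq_SucI)
    fix n
    have "0 \<le> \<sigma> * g (x n) * norm (x (Suc n) - x n)" using \<sigma> g_nonneg[of n] by simp
    then show "f (x (Suc n)) \<le> f (x n)" using A1[of n] by linarith
  qed
  have fc: "isCont f xs"
    using has_derivative_continuous[OF gderiv[OF xsM, unfolded gderiv_def]] .
  have "((\<lambda>n. f (x n)) \<circ> \<rho>) \<longlonglongrightarrow> f xs"
    using isCont_tendsto_compose[OF fc \<rho>(2)] by (simp add: o_def)
  from decseq_cluster_limit[OF dec \<rho>(1) this]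
  have e0: "e \<longlonglongrightarrow> 0" and e_nonneg: "\<And>n. 0 \<le> e n"
    unfolding e_def by (auto simp: LIM_zero_iff)
  obtain \<delta> \<Lambda> where \<delta>: "\<delta> > 0" "\<Lambda> > 0"
    and Loj: "\<And>y. y \<in> M \<Longrightarrow> norm (y - xs) < \<delta> \<Longrightarrow> \<bar>f y - f xs\<bar> powr (1 - \<theta>) \<le> \<Lambda> * g y"
    using \<open>lojasiewicz_at M f \<theta> xs\<close> unfolding lojasiewicz_at_def g_def by blast
  \<comment> \<open>Within \<open>\<delta>'\<close> both the Lojasiewicz inequality and the lower bound on the step length apply.\<close>
  define \<delta>' where "\<delta>' = min \<delta> (r/2)"
  have Loj': "e n powr (1 - \<theta>) \<le> \<Lambda> * g (x n)" if "norm (x n - xs) < \<delta>'" for n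
    using Loj[OF xM, of n] that e_nonneg[of n] by (simp add: e_def \<delta>'_def)
  have "\<exists>n\<^sub>0. \<exists>C>0. \<forall>n\<ge>n\<^sub>0. norm (x n - xs) < \<delta>' \<and> norm (x n - xs) \<le> C * e n powr \<theta>"
    by (rule Lojasiewicz_trajectory_bound[OF \<open>cluster_point x xs\<close> e_nonneg e0 g_nonneg _ \<sigma> A2 Loj'])
       (use A1 \<delta> r \<theta> in \<open>auto simp: e_def \<delta>'_def\<close>)
  then obtain n\<^sub>0 G where G: "G > 0" and near: "\<And>n. n \<ge> n\<^sub>0 \<Longrightarrow> norm (x n - xs) < \<delta>'"
    and dist: "\<And>n. n \<ge> n\<^sub>0 \<Longrightarrow> norm (x n - xs) \<le> G * e n powr \<theta>" by blast
  have A3': "\<kappa> * g (x n) \<le> norm (x (Suc n) - x n)" if "n \<ge> n\<^sub>0" for n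
    using near[OF that] by (intro A3) (simp add: \<delta>'_def dist_norm norm_minus_commute)

  have conditions: "\<exists>\<sigma>>0. \<exists>\<kappa>>0. \<forall>\<^sub>F n in sequentially.
            f (x (Suc n)) - f (x n) \<le> - \<sigma> * g (x n) * norm (x (Suc n) - x n) \<and>
            (g (x n) = 0 \<longrightarrow> x (Suc n) = x n) \<and> norm (x (Suc n) - x n) \<ge> \<kappa> * g (x n)"
    unfolding eventually_sequentially using \<sigma> \<kappa> A1 A2 A3' by blast

  have lim: "x \<longlonglongrightarrow> xs"
  proof -
    have "(\<lambda>n. e n powr \<theta>) \<longlonglongrightarrow> 0 powr \<theta>"
      using e_nonneg \<theta> by (intro tendsto_powr'[OF e0 tendsto_const]) auto
    then have "(\<lambda>n. G * e n powr \<theta>) \<longlonglongrightarrow> 0" by (intro tendsto_mult_right_zero) simp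
    then have "(\<lambda>n. x n - xs) \<longlonglongrightarrow> 0"
      by (rule Lim_null_comparison[rotated]) (use dist eventually_sequentially in blast)
    then show ?thesis by (simp add: LIM_zero_iff)
  qed

  have g2: "\<sigma> * \<kappa> * (g (x n))\<^sup>2 \<le> e n - e (Suc n)" if "n \<ge> n\<^sub>0" for n
  proof -
    have "(\<sigma> * g (x n)) * (\<kappa> * g (x n)) \<le> (\<sigma> * g (x n)) * norm (x (Suc n) - x n)"
      using \<sigma> g_nonneg[of n] A3'[OF that] by (intro mult_left_mono) auto
    then show ?thesis using A1[of n] by (simp add: e_def power2_eq_square ac_simps)
  qed
  have g0: "(\<lambda>n. g (x n)) \<longlonglongrightarrow> 0"
  proof -
    have "(\<lambda>n. (e n - e (Suc n)) / (\<sigma> * \<kappa>)) \<longlonglongrightarrow> (0 - 0) / (\<sigma> * \<kappa>)"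
      using \<sigma> \<kappa> by (intro tendsto_intros e0 LIMSEQ_Suc) auto
    moreover have "\<forall>\<^sub>F n in sequentially. norm ((g (x n))\<^sup>2) \<le> (e n - e (Suc n)) / (\<sigma> * \<kappa>)"
      using eventually_ge_at_top[of n\<^sub>0]
      by (rule eventually_mono) (use g2 \<sigma> \<kappa> in \<open>simp add: pos_le_divide_eq ac_simps\<close>)
    ultimately have "(\<lambda>n. (g (x n))\<^sup>2) \<longlonglongrightarrow> 0"
      by (intro Lim_null_comparison[of "\<lambda>n. (g (x n))\<^sup>2"]) simp_all
    from tendsto_real_sqrt[OF this] show ?thesis using g_nonneg by simp
  qed
  have "(\<lambda>n. grad f (x n) - grad f xs) \<longlonglongrightarrow> 0"
  proof (rule Lim_null_comparison)
    have "\<forall>\<^sub>F n in sequentially. x n \<in> ball xs (r/3)"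
      using topological_tendstoD[OF lim, of "ball xs (r/3)"] r by simp
    then show "\<forall>\<^sub>F n in sequentially. norm (grad f (x n) - grad f xs) \<le> 6 * K * norm (x n - xs)"
    proof (rule eventually_mono)
      fix n assume n: "x n \<in> ball xs (r/3)"
      define h where "h = grad f (x n) - grad f xs"
      have "norm h * norm h \<le> 6 * K * norm (x n - xs) * norm h"
        using quadratic_expansion_derivative_Lipschitz[OF q _ n, of xs h] r
        by (simp add: h_def dot_square_norm power2_eq_square flip: inner_diff_left)
      then show "norm (grad f (x n) - grad f xs) \<le> 6 * K * norm (x n - xs)"
        using r by (cases "h = 0") (auto simp: h_def)
    qed
    have "(\<lambda>n. 6 * K * norm (x n - xs)) \<longlonglongrightarrow> 6 * K * norm (xs - xs)" by (intro tendsto_intros lim)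
    then show "(\<lambda>n. 6 * K * norm (x n - xs)) \<longlonglongrightarrow> 0" by simp
  qed
  then have grad_lim: "(\<lambda>n. grad f (x n)) \<longlonglongrightarrow> grad f xs" by (simp add: LIM_zero_iff)
  have g_xs: "g xs = 0"
    unfolding g_def
    by (rule proj_antigrad_norm_limit_zero[OF W(1) xsM W(2,3) xM lim grad_lim g0[unfolded g_def]])

  define \<mu> where "\<mu> = \<sigma> * \<kappa> / \<Lambda>\<^sup>2"
  have \<mu>: "\<mu> > 0" using \<sigma> \<kappa> \<delta> by (simp add: \<mu>_def)
  have recursion: "e (Suc n) \<le> e n - \<mu> * e n powr (2 - 2 * \<theta>)" if n: "n \<ge> n\<^sub>0" for n
  proof -
    have "e n powr (2 - 2 * \<theta>) = (e n powr (1 - \<theta>))\<^sup>2"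
      by (simp add: power2_eq_square flip: powr_add)
    also have "\<dots> \<le> (\<Lambda> * g (x n))\<^sup>2" using Loj'[OF near[OF n]] by (intro power_mono) auto
    finally have "\<mu> * e n powr (2 - 2 * \<theta>) \<le> \<mu> * (\<Lambda> * g (x n))\<^sup>2" using \<mu> by (intro mult_left_mono) auto
    also have "\<dots> = \<sigma> * \<kappa> * (g (x n))\<^sup>2" using \<delta> by (simp add: \<mu>_def power_mult_distrib)
    finally show ?thesis using g2[OF n] by linarith
  qed

  have exponential: "\<exists>a>0. \<exists>C>0. \<forall>n. norm (x n - xs) \<le> C * exp (- a * real n)" if half: "\<theta> = 1 / 2"
  proof -
    have rec: "e (Suc n) \<le> e n - \<mu> * e n" if "n \<ge> n\<^sub>0" for n
      using recursion[OF that] e_nonneg[of n] by (simp add: half)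
    have "norm (x n - xs) \<le> G * (e n\<^sub>0 * exp (\<mu> * real n\<^sub>0)) powr (1/2) * exp (- (\<mu>/2) * real n)"
      if n: "n \<ge> n\<^sub>0" for n
    proof -
      have "e n \<le> e n\<^sub>0 * exp (\<mu> * real n\<^sub>0) * exp (- \<mu> * real n)"
        using geometric_decay[of e, OF e_nonneg rec n] n by (simp add: of_nat_diff algebra_simps flip: exp_add)
      then have "e n powr (1/2) \<le> (e n\<^sub>0 * exp (\<mu> * real n\<^sub>0) * exp (- \<mu> * real n)) powr (1/2)"
        using e_nonneg by (intro powr_mono2) auto
      also have "\<dots> = (e n\<^sub>0 * exp (\<mu> * real n\<^sub>0)) powr (1/2) * exp (- (\<mu>/2) * real n)"
        unfolding powr_mult exp_powr_real by simp
      finally have "G * e n powr (1/2)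
          \<le> G * ((e n\<^sub>0 * exp (\<mu> * real n\<^sub>0)) powr (1/2) * exp (- (\<mu>/2) * real n))"
        using G by (intro mult_left_mono) auto
      then show ?thesis using dist[OF n] by (simp only: half mult.assoc)
    qed
    from eventual_bound_extends[where k = 0, OF this]
    show ?thesis using \<mu> by (intro exI[of _ "\<mu>/2"]) auto
  qed

  have polynomial: "\<exists>C>0. \<forall>n\<ge>1. norm (x n - xs) \<le> C * real n powr (- (\<theta> / (1 - 2 * \<theta>)))"
    if less: "\<theta> < 1 / 2"
  proof -
    define q where "q = 1 - 2 * \<theta>"
    have q: "q > 0" "2 - 2 * \<theta> = 1 + q" using less by (auto simp: q_def)
    have bound: "norm (x n - xs) \<le> (G * (q * \<mu> / 2) powr (- (\<theta> / q))) * real n powr (- (\<theta> / q))"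
      if n: "n \<ge> 2 * n\<^sub>0 + 1" for n
    proof -
      have "e n powr \<theta> \<le> (q * \<mu> / 2) powr (- (\<theta> / q)) * real n powr (- (\<theta> / q))"
        by (rule polynomial_decay[of e, OF e_nonneg recursion[unfolded q(2)] \<mu> q(1) _ _ \<theta>(1)]) (use n in auto)
      then have "G * e n powr \<theta> \<le> G * ((q * \<mu> / 2) powr (- (\<theta> / q)) * real n powr (- (\<theta> / q)))"
        using G by (intro mult_left_mono) auto
      moreover have "norm (x n - xs) \<le> G * e n powr \<theta>" using n by (intro dist) auto
      ultimately show ?thesis by (simp only: mult.assoc)
    qed
    show ?thesis
      using eventual_bound_extends[where k = 1, OF bound] unfolding q_def by simp
  qed

  show ?thesis
    using conditions lim exponential polynomial g0 g_xs unfolding g_def by blast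
qed

end
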